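(* Let $\Gamma$ be a graph with graph-associahedron $\mathcal{P}\Gamma$. The facets of $\mathcal{P}\Gamma$ correspond to the set of $1$-tubings on $\Gamma$. In particular, the facet associated to a $1$-tubing $\{t\}$ is combinatorially equivalent to $\mathcal{P}\Gamma_t \times \mathcal{P}\Gamma^*_t$, the product of the graph-associahedra of the induced subgraph $\Gamma_t$ and of the reconnected complement $\Gamma^*_t$.
   Context: Graphs have finitely many nodes. A *tube* of $\Gamma$ is a proper nonempty set of nodes of $\Gamma$ whose induced graph is a proper, connected subgraph of $\Gamma$. Two tubes $t_1,t_2$ are *nested* if $t_1\subset t_2$; they *intersect* if $t_1\cap t_2\neq\emptyset$ and $t_1\not\subset t_2$ and $t_2\not\subset t_1$; they are *adjacent* if $t_1\cap t_2=\emptyset$ and $t_1\cup t_2$ is a tube in $\Gamma$. Tubes are *compatible* if they do not intersect and they are not adjacent. A *tubing* of $\Gamma$ is a set of tubes of $\Gamma$ (possibly empty) such that every pair of its tubes is compatible; a *$k$-tubing* is a tubing with $k$ tubes. Graph-associahedron: if $\Gamma$ has $n$ nodes, let $\triangle_\Gamma$ be the $(n-1)$-simplex in which each facet (codimension $1$ face) corresponds to a particular node of $\Gamma$. Each proper subset of nodes corresponds to a unique face of $\triangle_\Gamma$, defined by the intersection of the facets associated to those nodes; the empty set corresponds to $\triangle_\Gamma$ itself. The graph-associahedron $\mathcal{P}\Gamma$ is the polytope obtained from $\triangle_\Gamma$ by truncating the faces which correspond to $1$-tubings in increasing order of dimension. Here truncating a polytope $P$ at a face $f$ means intersecting $P$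 with a closed halfspace $H^+$ such that a vertex of $P$ is in $H^+$ if and only if it is not in $f$, and no vertex of $P$ lies on the bounding hyperplane. The face poset of $\mathcal{P}\Gamma$ is identified with the set of tubings of $\Gamma$, ordered such that $T\prec T'$ if $T$ is obtained from $T'$ by adding tubes; the facet associated to $\{t\}$ is the one corresponding to the tubing $\{t\}$, and the faces contained in it are the tubings that contain $t$. For a tube $t$, $\Gamma_t$ is the subgraph of $\Gamma$ induced on $t$. The *reconnected complement* $\Gamma^*_t$ is the graph with node set $V-t$, where $V$ is the set of nodes of $\Gamma$, with an edge between nodes $a$ and $b$ if either $\{a,b\}$ or $\{a,b\}\cup t$ is connected in $\Gamma$. Combinatorially equivalent means having isomorphic face posets. *)

theory Defs
  imports "HOL-Analysis.Analysis" "Graph_Theory.Digraph_Component"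
begin

text \<open>
  A finite simple graph is a digraph satisfying the locale predicate \<open>Digraph.graph\<close>: an
  undirected edge is a pair of opposite arcs. \<open>Digraph_Component.connected\<close> is connectedness of
  graphs (which includes having at least one node), not the topological notion of the same name.
\<close>

definition tube :: "('v, 'e) pre_digraph \<Rightarrow> 'v set \<Rightarrow> bool" where
  "tube \<Gamma> t \<longleftrightarrow> t \<noteq> {} \<and> t \<subset> verts \<Gamma> \<and> Digraph_Component.connected (\<Gamma> \<restriction> t)"

definition tubes_intersect :: "'v set \<Rightarrow> 'v set \<Rightarrow> bool" where
  "tubes_intersect t1 t2 \<longleftrightarrow> t1 \<inter> t2 \<noteq> {} \<and> \<not> t1 \<subseteq> t2 \<and> \<not> t2 \<subseteq> t1"

definition tubes_adjacent :: "('v, 'e) pre_digraph \<Rightarrow> 'v set \<Rightarrow> 'v set \<Rightarrow> bool" where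
  "tubes_adjacent \<Gamma> t1 t2 \<longleftrightarrow> t1 \<inter> t2 = {} \<and> tube \<Gamma> (t1 \<union> t2)"

definition tubing :: "('v, 'e) pre_digraph \<Rightarrow> 'v set set \<Rightarrow> bool" where
  "tubing \<Gamma> T \<longleftrightarrow> (\<forall>t\<in>T. tube \<Gamma> t) \<and>
     (\<forall>t1\<in>T. \<forall>t2\<in>T. \<not> tubes_intersect t1 t2 \<and> \<not> tubes_adjacent \<Gamma> t1 t2)"

definition k_tubing :: "('v, 'e) pre_digraph \<Rightarrow> nat \<Rightarrow> 'v set set \<Rightarrow> bool" where
  "k_tubing \<Gamma> k T \<longleftrightarrow> tubing \<Gamma> T \<and> finite T \<and> card T = k"

definition reconnected_complement ::
    "('v, 'e) pre_digraph \<Rightarrow> 'v set \<Rightarrow> ('v, 'v \<times> 'v) pre_digraph" where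
  "reconnected_complement \<Gamma> t = with_proj
     \<lparr> pverts = verts \<Gamma> - t,
       parcs = {(a, b). a \<in> verts \<Gamma> - t \<and> b \<in> verts \<Gamma> - t \<and> a \<noteq> b \<and>
         (Digraph_Component.connected (\<Gamma> \<restriction> {a, b}) \<or>
          Digraph_Component.connected (\<Gamma> \<restriction> ({a, b} \<union> t)))} \<rparr>"

text \<open>
  \<open>\<Delta>\<close> is a simplex whose codimension 1 faces are labelled by the elements of \<open>V\<close>, via \<open>G\<close>.
  The library's \<open>facet_of\<close> is not used here because it demands a nonempty face: for a single node,
  \<open>\<Delta>\<close> is a point and its codimension 1 face is empty.
\<close>

definition labelled_simplex :: "'v set \<Rightarrow> 'a::euclidean_space set \<Rightarrow> ('v \<Rightarrow> 'a set) \<Rightarrow> bool" where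
  "labelled_simplex V \<Delta> G \<longleftrightarrow> (int (card V) - 1) simplex \<Delta> \<and>
     bij_betw G V {F. F face_of \<Delta> \<and> aff_dim F = aff_dim \<Delta> - 1}"

definition simplex_face :: "'a set \<Rightarrow> ('v \<Rightarrow> 'a set) \<Rightarrow> 'v set \<Rightarrow> 'a set" where
  "simplex_face \<Delta> G S = \<Delta> \<inter> (\<Inter>v\<in>S. G v)"

text \<open>The closed halfspace \<open>{x. a \<bullet> x \<le> b}\<close> truncates \<open>P\<close> at its face \<open>f\<close>.\<close>

definition truncates :: "'a::euclidean_space set \<Rightarrow> 'a set \<Rightarrow> 'a \<Rightarrow> real \<Rightarrow> bool" where
  "truncates P f a b \<longleftrightarrow> f face_of P \<and> a \<noteq> 0 \<and>
     (\<forall>v. v extreme_point_of P \<longrightarrow> (a \<bullet> v \<le> b \<longleftrightarrow> v \<notin> f) \<and> a \<bullet> v \<noteq> b)"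

definition truncation_stage ::
    "'a::euclidean_space set \<Rightarrow> ('v set \<Rightarrow> 'a) \<Rightarrow> ('v set \<Rightarrow> real) \<Rightarrow> 'v set list \<Rightarrow> 'a set" where
  "truncation_stage \<Delta> a b ts = \<Delta> \<inter> (\<Inter>t\<in>set ts. {x. a t \<bullet> x \<le> b t})"

text \<open>
  The graph-associahedron of \<open>\<Gamma>\<close> depends on the choice of the simplex, of the halfspaces and of the
  order among faces of equal dimension, so it is a predicate that holds for every polytope \<open>P\<close>
  arising from some such choice. The list \<open>ts\<close> records the order of the truncations. When the turn
  of \<open>t\<close> comes, the face to cut off is what is left of the simplex face of \<open>t\<close> in the polytope
  truncated so far. \<open>F t\<close> is the facet of \<open>P\<close> created by the truncation at \<open>t\<close>; its values outside
  the tubes are irrelevant.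
\<close>

definition graph_associahedron ::
    "('v, 'e) pre_digraph \<Rightarrow> 'a::euclidean_space set \<Rightarrow> ('v set \<Rightarrow> 'a set) \<Rightarrow> bool" where
  "graph_associahedron \<Gamma> P F \<longleftrightarrow> (\<exists>\<Delta> G ts a b.
     labelled_simplex (verts \<Gamma>) \<Delta> G \<and>
     distinct ts \<and> set ts = {t. tube \<Gamma> t} \<and>
     sorted_wrt (\<lambda>s t. aff_dim (simplex_face \<Delta> G s) \<le> aff_dim (simplex_face \<Delta> G t)) ts \<and>
     (\<forall>i<length ts.
        truncates (truncation_stage \<Delta> a b (take i ts))
          (simplex_face \<Delta> G (ts ! i) \<inter> truncation_stage \<Delta> a b (take i ts))
          (a (ts ! i)) (b (ts ! i))) \<and>
     P = truncation_stage \<Delta> a b ts \<and>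
     (\<forall>t. tube \<Gamma> t \<longrightarrow> F t = P \<inter> {x. a t \<bullet> x = b t}))"

text \<open>
  The face of \<open>P\<close> corresponding to the tubing \<open>T\<close>: the whole of \<open>P\<close> for the empty tubing, and the
  facet \<open>F t\<close> for the 1-tubing \<open>{t}\<close>.
\<close>

definition tubing_face :: "'a set \<Rightarrow> ('v set \<Rightarrow> 'a set) \<Rightarrow> 'v set set \<Rightarrow> 'a set" where
  "tubing_face P F T = P \<inter> (\<Inter>t\<in>T. F t)"

text \<open>The empty face is not part of the face poset, which is to have one element per tubing.\<close>

definition face_poset :: "'a::real_vector set \<Rightarrow> 'a set set" where
  "face_poset P = {f. f face_of P \<and> f \<noteq> {}}"

definition combinatorially_equivalent ::
    "'a::real_vector set \<Rightarrow> 'b::real_vector set \<Rightarrow> bool" where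
  "combinatorially_equivalent P Q \<longleftrightarrow> (\<exists>\<phi>. bij_betw \<phi> (face_poset P) (face_poset Q) \<and>
     (\<forall>f\<in>face_poset P. \<forall>g\<in>face_poset P. f \<subseteq> g \<longleftrightarrow> \<phi> f \<subseteq> \<phi> g))"

end

theory Submission
  imports Defs
begin

text \<open>
  Describe a point \<open>x\<close> of a polytope given by affine inequalities by its set of active constraints.
  The nonempty faces of the polytope are anti-isomorphic to the family \<open>K\<close> of all sets that arise in
  this way. If \<open>K\<close> is closed under subsets, then truncating the face on which the constraints \<open>S\<close> are
  active, by a new constraint \<open>n\<close>, turns \<open>K\<close> into
  \<open>{X \<in> K. \<not> S \<subseteq> X} \<union> {insert n X |X. X \<in> K \<and> \<not> S \<subseteq> X \<and> X \<union> S \<in> K}\<close>: only the position of the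
  vertices relative to the new hyperplane matters.
  Starting from a simplex and truncating at the tubes in order of decreasing size, induction yields
  the complex of nested sets of the building set formed by the tubes and the whole node set. The
  link of \<open>t\<close> in that complex is the join of the complexes of the restriction to \<open>t\<close> and of the
  contraction of \<open>t\<close>, and these two building sets come from \<open>\<Gamma> \<restriction> t\<close> and the reconnected
  complement.
\<close>

text \<open>The cutting hyperplanes are constrained only through the vertices, so the metric shape
  of \<open>P\<close> is unknown and all information must pass through \<open>K\<close>. The rule
  for \<open>K\<close> is stellar subdivision at \<open>S\<close>; it needs \<open>K\<close> to be a
  simplicial complex at every stage, which holds because subfamilies of nested families are nested.

  Nestedness says that a subfamily whose union lies in \<open>B\<close> has a greatest member.
  Closure of \<open>B\<close> under overlapping unions then makes overlapping members comparable,
  and disjoint members must not have a union in \<open>B\<close>. Arbitrary subfamilies are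
  considered, and the node set is put into \<open>B\<close> even when the graph is disconnected: for
  three isolated nodes any two facets meet, while all three do not.

  Truncating larger tubes first puts the union of two overlapping tubes, if proper, no later than
  either of them. So the singletons, the node set and the tubes used so far are always closed under
  overlapping unions, and the new tube contains no earlier one; this is what turns adding a tube
  into a stellar subdivision.\<close>

section \<open>Nested sets of a building set\<close>

text \<open>
  For \<open>M = {}\<close> the condition says \<open>{} \<notin> B\<close>; so nothing is nested when \<open>V = {}\<close> and \<open>V \<in> B\<close>, which
  matches the empty polytope of the empty graph.
\<close>

definition nested :: "'v set set \<Rightarrow> 'v set \<Rightarrow> 'v set set \<Rightarrow> bool" where
  "nested B V N \<longleftrightarrow> N \<subseteq> B - {V} \<and> (\<forall>M\<subseteq>N. \<Union>M \<in> B \<longrightarrow> \<Union>M \<in> M)"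

lemma nested_subset: "nested B V N \<Longrightarrow> M \<subseteq> N \<Longrightarrow> nested B V M"
  unfolding nested_def by blast

lemma nestedD: "nested B V N \<Longrightarrow> M \<subseteq> N \<Longrightarrow> \<Union>M \<in> B \<Longrightarrow> \<Union>M \<in> M"
  unfolding nested_def by blast

lemma nested_in: "nested B V N \<Longrightarrow> s \<in> N \<Longrightarrow> s \<in> B \<and> s \<noteq> V"
  unfolding nested_def by blast

section \<open>The link of a member of a building set\<close>

definition building_set :: "'v set \<Rightarrow> 'v set set \<Rightarrow> bool" where
  "building_set V B \<longleftrightarrow> B \<subseteq> Pow V - {{}} \<and> V \<in> B \<and>
     (\<forall>s\<in>B. \<forall>t\<in>B. s \<inter> t \<noteq> {} \<longrightarrow> s \<union> t \<in> B)"

definition restriction :: "'v set set \<Rightarrow> 'v set \<Rightarrow> 'v set set" where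
  "restriction B t = {s \<in> B. s \<subseteq> t}"

text \<open>For a building set with \<open>t \<in> B\<close> this is the family of all
  \<open>s - t\<close> with \<open>s \<in> B\<close> not inside \<open>t\<close>: a member meeting
  \<open>t\<close> can be enlarged by \<open>t\<close> without leaving \<open>B\<close>. In this
  form it matches the edge rule of the reconnected complement.\<close>

definition contraction :: "'v set \<Rightarrow> 'v set set \<Rightarrow> 'v set \<Rightarrow> 'v set set" where
  "contraction V B t = {s. s \<noteq> {} \<and> s \<subseteq> V - t \<and> (s \<in> B \<or> s \<union> t \<in> B)}"

text \<open>Recovers from \<open>s - t\<close> a member \<open>s\<close>, not contained in \<open>t\<close>, of a nested set containing \<open>t\<close>.\<close>

definition link_lift :: "'v set set \<Rightarrow> 'v set \<Rightarrow> 'v set \<Rightarrow> 'v set" where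
  "link_lift B t s = (if s \<union> t \<in> B then s \<union> t else s)"

definition link_join :: "'v set set \<Rightarrow> 'v set \<Rightarrow> 'v set set \<times> 'v set set \<Rightarrow> 'v set set" where
  "link_join B t = (\<lambda>(X, Y). X \<union> {t} \<union> link_lift B t ` Y)"

definition link_split :: "'v set \<Rightarrow> 'v set set \<Rightarrow> 'v set set \<times> 'v set set" where
  "link_split t N = ({s \<in> N. s \<subset> t}, {s - t |s. s \<in> N \<and> \<not> s \<subseteq> t})"

context
  fixes V :: "'v set" and B t
  assumes bs: "building_set V B" and tB: "t \<in> B" and tV: "t \<noteq> V"
begin

lemma building_set_member: "s \<in> B \<Longrightarrow> s \<subseteq> V \<and> s \<noteq> {}"
  and building_set_ground: "V \<in> B"
  and building_set_Un: "s \<in> B \<Longrightarrow> s' \<in> B \<Longrightarrow> s \<inter> s' \<noteq> {} \<Longrightarrow> s \<union> s' \<in> B"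
  using bs unfolding building_set_def by blast+

text \<open>An overlap with \<open>t\<close> puts \<open>s \<union> t\<close> into \<open>B\<close>,
  and nestedness of the pair then forces inclusion. The third case keeps
  \<open>s \<union> t \<notin> B\<close>, the very test that makes \<open>link_lift\<close> return
  \<open>s\<close> unchanged.\<close>

lemma nested_link_cases:
  assumes N: "nested B V N" "t \<in> N" and s: "s \<in> N"
  obtains "s \<subseteq> t" | "t \<subset> s" | "s \<inter> t = {}" "s \<union> t \<notin> B"
proof -
  have "s \<union> t \<in> {s,t}" if "s \<union> t \<in> B"
    using nestedD[OF N(1), of "{s,t}"] N(2) s that by auto
  moreover have "s \<in> B" using nested_in N(1) s by blast
  ultimately have "s \<subseteq> t \<or> t \<subseteq> s" if "s \<union> t \<in> B \<or> s \<inter> t \<noteq> {}"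
    using that building_set_Un[of s t] tB by blast
  then show ?thesis using that by blast
qed

text \<open>The difficulty is the second component: a union of differences may reach
  \<open>B\<close> only after adding \<open>t\<close>. Either some member of the corresponding
  subfamily of \<open>N\<close> already contains \<open>t\<close>, or \<open>t\<close> is adjoined
  before nestedness of \<open>N\<close> is applied.\<close>

lemma link_split_nested:
  assumes N: "nested B V N" "t \<in> N"
  shows "link_split t N \<in> {X. nested (restriction B t) t X} \<times> {Y. nested (contraction V B t) (V - t) Y}"
proof -
  have 1: "nested (restriction B t) t {s \<in> N. s \<subset> t}"
    using N unfolding nested_def restriction_def by blast
  let ?Y = "{s - t |s. s \<in> N \<and> \<not> s \<subseteq> t}"
  have "s - t \<in> contraction V B t - {V - t}" if s: "s \<in> N" "\<not> s \<subseteq> t" for s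
  proof -
    have sB: "s \<in> B" "s \<noteq> V" "s \<subseteq> V" using nested_in[OF N(1) s(1)] building_set_member by auto
    show ?thesis
    proof (rule nested_link_cases[OF N s(1)])
      assume "s \<subseteq> t" then show ?thesis using s by simp
    next
      assume a: "t \<subset> s"
      then have "s - t \<union> t = s" by blast
      then show ?thesis using a sB s(2) unfolding contraction_def by auto
    next
      assume a: "s \<inter> t = {}" "s \<union> t \<notin> B"
      then have "s - t = s" by blast
      \<comment> \<open>Otherwise \<open>s \<union> t\<close> would be the ground set, which lies in
        \<open>B\<close>.\<close>
      moreover have "s \<noteq> V - t" using a building_set_ground building_set_member[OF tB]
        by (metis Un_Diff_cancel2 sup.absorb1)
      ultimately show ?thesis using sB building_set_member[of s] a unfolding contraction_def by auto
    qed
  qed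
  then have sub: "?Y \<subseteq> contraction V B t - {V - t}" by blast
  have "\<Union>M' \<in> M'" if M': "M' \<subseteq> ?Y" and U: "\<Union>M' \<in> contraction V B t" for M'
  proof -
    define M where "M = {s \<in> N. \<not> s \<subseteq> t \<and> s - t \<in> M'}"
    have MN: "M \<subseteq> N" unfolding M_def by blast
    have "(\<lambda>s. s - t) ` M \<subseteq> M'" unfolding M_def by blast
    moreover have "x \<in> (\<lambda>s. s - t) ` M" if x: "x \<in> M'" for x
    proof -
      obtain s where "x = s - t" "s \<in> N" "\<not> s \<subseteq> t" using x M' by blast
      then show ?thesis using x unfolding M_def by blast
    qed
    ultimately have M'M: "M' = (\<lambda>s. s - t) ` M" by blast
    have UM: "\<Union>M' = \<Union>M - t" unfolding M'M by blast
    have U': "\<Union>M' \<noteq> {}" "\<Union>M' \<in> B \<or> \<Union>M' \<union> t \<in> B"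
      using U unfolding contraction_def by auto
    \<comment> \<open>A greatest member of \<open>M\<close> becomes a greatest member of
      \<open>M'\<close> after removing \<open>t\<close>.\<close>
    have done_if: "\<Union>M' \<in> M'" if "\<Union>M \<in> B"
      unfolding UM by (subst M'M) (rule imageI, rule nestedD[OF N(1) MN that])
    show ?thesis
    proof (cases "\<exists>s\<in>M. t \<subset> s")
      case True
      then obtain s where s: "s \<in> M" "t \<subset> s" by blast
      then have sM: "t \<subseteq> \<Union>M" "s \<subseteq> \<Union>M" and ne: "s - t \<noteq> {}" by blast+
      \<comment> \<open>Whichever of \<open>\<Union>M'\<close> and
        \<open>\<Union>M' \<union> t\<close> lies in \<open>B\<close>, so does
        \<open>\<Union>M\<close>: the second equality serves the first case, because
        \<open>\<Union>M'\<close> overlaps \<open>s\<close>.\<close>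
      have e: "\<Union>M = \<Union>M' \<union> t" "\<Union>M = \<Union>M' \<union> s"
        unfolding UM using s(2) sM by auto
      have "\<Union>M' \<inter> s \<noteq> {}" unfolding UM using sM ne by auto
      have "s \<in> B" using s MN N(1) nested_in by blast
      then have "\<Union>M \<in> B" using U'(2) e building_set_Un[of "\<Union>M'" s] \<open>\<Union>M' \<inter> s \<noteq> {}\<close> by auto
      then show ?thesis by (rule done_if)
    next
      case False
      then have disj: "s \<inter> t = {}" if "s \<in> M" for s
        using nested_link_cases[OF N, of s] that MN unfolding M_def by blast
      then have e: "\<Union>M' = \<Union>M" unfolding UM by blast
      show ?thesis
      proof (cases "\<Union>M' \<in> B")
        case True then show ?thesis using done_if e by metis
      next
        case False
        \<comment> \<open>All of \<open>M\<close> misses \<open>t\<close> here, so the greatest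
          member obtained after adjoining \<open>t\<close> can be neither \<open>t\<close> nor a
          member of \<open>M\<close>.\<close>
        then have "\<Union>(insert t M) \<in> B" using U' e by (simp add: Un_commute)
        then have "\<Union>(insert t M) \<in> insert t M" using nestedD[OF N(1)] MN N(2) by blast
        then consider "t \<union> \<Union>M = t" | "t \<union> \<Union>M \<in> M" by auto
        then show ?thesis
        proof cases
          case 1
          then have "\<Union>M \<subseteq> t" by blast
          moreover have "\<Union>M \<inter> t = {}" using disj by blast
          ultimately show ?thesis using U'(1) e by blast
        next
          case 2
          then have "(t \<union> \<Union>M) \<inter> t = {}" by (rule disj)
          then show ?thesis using building_set_member[OF tB] by blast
        qed
      qed
    qed
  qed
  then have "nested (contraction V B t) (V - t) ?Y" using sub unfolding nested_def by blast
  then show ?thesis using 1 unfolding link_split_def by blast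
qed

lemma link_lift_props:
  assumes "s \<in> contraction V B t"
  shows "link_lift B t s \<in> B" "link_lift B t s - t = s" "\<not> link_lift B t s \<subseteq> t"
  using assms unfolding contraction_def link_lift_def by auto

text \<open>A subfamily lying inside \<open>t\<close> is handled by \<open>X\<close>. Otherwise its
  members not inside \<open>t\<close> come from a subfamily \<open>M2\<close> of \<open>Y\<close>,
  whose greatest member lifts to the greatest member of the whole subfamily.\<close>

lemma link_join_nested:
  assumes X: "nested (restriction B t) t X" and Y: "nested (contraction V B t) (V - t) Y"
  shows "nested B V (link_join B t (X, Y))" "t \<in> link_join B t (X, Y)"
proof -
  have Yc: "s \<in> contraction V B t" "s \<noteq> V - t" if "s \<in> Y" for s using Y that nested_in by blast+
  have Xr: "s \<in> B" "s \<subset> t" if "s \<in> X" for s using nested_in[OF X that] unfolding restriction_def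
    by auto
  have tV': "t \<subseteq> V" "t \<noteq> {}" using building_set_member[OF tB] by auto
  let ?N = "link_join B t (X, Y)"
  have N: "?N = X \<union> {t} \<union> link_lift B t ` Y" unfolding link_join_def by simp
  have "?N \<subseteq> B - {V}" using Xr tB tV tV' link_lift_props Yc unfolding N by blast
  moreover have "\<Union>M \<in> M" if M: "M \<subseteq> ?N" and U: "\<Union>M \<in> B" for M
  proof -
    define M2 where "M2 = {s \<in> Y. link_lift B t s \<in> M}"
    have M2Y: "M2 \<subseteq> Y" unfolding M2_def by blast
    have Mcases: "s \<subseteq> t \<or> (\<exists>r\<in>M2. s = link_lift B t r)" if "s \<in> M" for s
      using that M Xr unfolding N M2_def by blast
    have U2: "\<Union>M2 = \<Union>M - t"
    proof -
      have "s - t \<subseteq> \<Union>M2" if "s \<in> M" for s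
        using Mcases[OF that] link_lift_props(2) Yc(1) M2Y by blast
      moreover have "s \<subseteq> \<Union>M - t" if "s \<in> M2" for s
        using link_lift_props(2)[OF Yc(1), of s] that unfolding M2_def by blast
      ultimately show ?thesis by blast
    qed
    show ?thesis
    proof (cases "M2 = {}")
      case True
      then have sub: "M \<subseteq> X \<union> {t}" using M unfolding N M2_def by blast
      show ?thesis
      proof (cases "t \<in> M")
        case True
        then have "\<Union>M = t" using sub Xr by blast
        then show ?thesis using True by simp
      next
        case False
        then have "M \<subseteq> X" using sub by blast
        moreover have "\<Union>M \<in> restriction B t" using U \<open>M \<subseteq> X\<close> Xr unfolding restriction_def by blast
        ultimately show ?thesis using nestedD[OF X] by blast
      qed
    next
      case False
      then have ne: "\<Union>M2 \<noteq> {}" using Yc(1) M2Y unfolding contraction_def by blast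
      \<comment> \<open>Here \<open>\<Union>M \<union> t\<close> is the union of two overlapping
        members of \<open>B\<close>, and it equals \<open>\<Union>M2 \<union> t\<close>.\<close>
      have hit: "\<Union>M2 \<union> t \<in> B" if "\<Union>M \<inter> t \<noteq> {}"
        using building_set_Un[OF U tB that] U2 by simp
      have "\<Union>M2 \<in> contraction V B t"
      proof (cases "\<Union>M \<inter> t = {}")
        case True
        then have "\<Union>M2 = \<Union>M" using U2 by blast
        then show ?thesis using U ne building_set_member[OF U] True unfolding contraction_def
          by auto
      next
        case False
        then show ?thesis using hit ne U2 building_set_member[OF U] unfolding contraction_def
          by auto
      qed
      then have "\<Union>M2 \<in> M2" using nestedD[OF Y M2Y] by blast
      then have inM: "link_lift B t (\<Union>M2) \<in> M" unfolding M2_def by blast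
      \<comment> \<open>If the lift adds \<open>t\<close>, it contains all of \<open>M\<close> and
        is itself in \<open>M\<close>; if it does not, \<open>hit\<close> shows that
        \<open>M\<close> avoids \<open>t\<close>.\<close>
      have "link_lift B t (\<Union>M2) = \<Union>M"
      proof (cases "\<Union>M2 \<union> t \<in> B")
        case True
        then have "link_lift B t (\<Union>M2) = \<Union>M2 \<union> t" unfolding link_lift_def by simp
        then show ?thesis using inM U2 by blast
      next
        case False
        then have "\<Union>M \<inter> t = {}" using hit by blast
        then show ?thesis using False U2 unfolding link_lift_def by auto
      qed
      then show ?thesis using inM by simp
    qed
  qed
  ultimately show "nested B V ?N" unfolding nested_def by blast
  show "t \<in> ?N" unfolding N by blast
qed

lemma link_split_join:
  assumes X: "nested (restriction B t) t X" and Y: "nested (contraction V B t) (V - t) Y"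
  shows "link_split t (link_join B t (X, Y)) = (X, Y)"
proof -
  have Yc: "s \<in> contraction V B t" if "s \<in> Y" for s using Y that nested_in by blast
  have Xr: "s \<subset> t" if "s \<in> X" for s using nested_in[OF X that] unfolding restriction_def by auto
  let ?N = "link_join B t (X, Y)"
  have N: "?N = X \<union> {t} \<union> link_lift B t ` Y" unfolding link_join_def by simp
  have 1: "{s \<in> ?N. s \<subset> t} = X" unfolding N using Xr link_lift_props(3) Yc by blast
  have "{s \<in> ?N. \<not> s \<subseteq> t} = link_lift B t ` Y"
    unfolding N using Xr link_lift_props(3) Yc by blast
  moreover have "{s - t |s. s \<in> ?N \<and> \<not> s \<subseteq> t} = (\<lambda>s. s - t) ` {s \<in> ?N. \<not> s \<subseteq> t}" by blast
  ultimately have "{s - t |s. s \<in> ?N \<and> \<not> s \<subseteq> t} = (\<lambda>s. s - t) ` link_lift B t ` Y" by simp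
  then have "{s - t |s. s \<in> ?N \<and> \<not> s \<subseteq> t} = Y"
    using link_lift_props(2) Yc by (simp add: image_image cong: image_cong)
  then show ?thesis using 1 unfolding link_split_def by simp
qed

lemma link_join_split:
  assumes N: "nested B V N" "t \<in> N"
  shows "link_join B t (link_split t N) = N"
proof -
  have "link_lift B t (s - t) = s" if s: "s \<in> N" "\<not> s \<subseteq> t" for s
  proof (rule nested_link_cases[OF N s(1)])
    assume a: "t \<subset> s"
    then have "s - t \<union> t = s" by blast
    then show ?thesis using nested_in[OF N(1) s(1)] unfolding link_lift_def by simp
  next
    assume a: "s \<inter> t = {}" "s \<union> t \<notin> B"
    then have "s - t = s" by blast
    then show ?thesis using a unfolding link_lift_def by simp
  qed (use s in simp)
  then have "(\<lambda>s. link_lift B t (s - t)) ` {s \<in> N. \<not> s \<subseteq> t} = {s \<in> N. \<not> s \<subseteq> t}" by simp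
  moreover have "{s - t |s. s \<in> N \<and> \<not> s \<subseteq> t} = (\<lambda>s. s - t) ` {s \<in> N. \<not> s \<subseteq> t}" by blast
  ultimately have "link_lift B t ` {s - t |s. s \<in> N \<and> \<not> s \<subseteq> t} = {s \<in> N. \<not> s \<subseteq> t}"
    by (simp add: image_image)
  then show ?thesis using N(2) unfolding link_join_def link_split_def by auto
qed

lemma link_join_mono: "X \<subseteq> X' \<Longrightarrow> Y \<subseteq> Y' \<Longrightarrow> link_join B t (X, Y) \<subseteq> link_join B t (X', Y')"
  unfolding link_join_def by auto

lemma link_split_mono: "N \<subseteq> N' \<Longrightarrow> fst (link_split t N) \<subseteq> fst (link_split t N') \<and> snd (link_split t N) \<subseteq> snd (link_split t N')"
  unfolding link_split_def by auto

text \<open>The inverse \<open>link_split\<close> is monotone too, so \<open>link_join\<close> also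
  reflects the order.\<close>

lemma nested_link:
  defines "L \<equiv> {X. nested (restriction B t) t X} \<times> {Y. nested (contraction V B t) (V - t) Y}"
  shows "bij_betw (link_join B t) L {N. nested B V N \<and> t \<in> N}"
    and "p \<in> L \<Longrightarrow> q \<in> L \<Longrightarrow>
      link_join B t p \<subseteq> link_join B t q \<longleftrightarrow> fst p \<subseteq> fst q \<and> snd p \<subseteq> snd q"
proof -
  have sj: "link_split t (link_join B t p) = p" if "p \<in> L" for p using that link_split_join
    unfolding L_def by auto
  show "bij_betw (link_join B t) L {N. nested B V N \<and> t \<in> N}"
  proof (rule bij_betw_byWitness[where f' = "link_split t"])
    show "link_join B t ` L \<subseteq> {N. nested B V N \<and> t \<in> N}"
      using link_join_nested unfolding L_def by blast
    show "link_split t ` {N. nested B V N \<and> t \<in> N} \<subseteq> L"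
      using link_split_nested unfolding L_def by blast
  qed (use sj link_join_split in auto)
  show "link_join B t p \<subseteq> link_join B t q \<longleftrightarrow> fst p \<subseteq> fst q \<and> snd p \<subseteq> snd q" if "p \<in> L" "q \<in> L"
  proof
    assume "link_join B t p \<subseteq> link_join B t q"
    from link_split_mono[OF this] show "fst p \<subseteq> fst q \<and> snd p \<subseteq> snd q" using sj that by simp
  next
    assume "fst p \<subseteq> fst q \<and> snd p \<subseteq> snd q"
    then show "link_join B t p \<subseteq> link_join B t q"
      using link_join_mono[of "fst p" "fst q" "snd p" "snd q"] by simp
  qed
qed

end

section \<open>Adding one set to a building set\<close>

definition singletons :: "'v set \<Rightarrow> 'v set set" where
  "singletons S = (\<lambda>v. {v}) ` S"

lemma Union_singletons [simp]: "\<Union>(singletons S) = S"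
  unfolding singletons_def by auto

context
  fixes V :: "'v set" and B S
  assumes S: "S \<notin> B" "S \<noteq> V" and two: "\<And>v. S \<noteq> {v}"
    and Bsub: "s \<in> B \<Longrightarrow> s \<subseteq> S \<Longrightarrow> s \<in> singletons S"
    and ne: "{} \<notin> B"
    and single: "v \<in> S \<Longrightarrow> {v} \<in> B" "v \<in> S \<Longrightarrow> {v} \<noteq> V"
    and un: "s \<in> B \<Longrightarrow> s \<inter> S \<noteq> {} \<Longrightarrow> s \<in> singletons S \<or> s \<union> S \<in> B"
begin

text \<open>The only new requirement concerns subfamilies with union \<open>S\<close>. As
  \<open>B\<close> has only singletons inside \<open>S\<close>, such a subfamily is exactly
  \<open>singletons S\<close>, and it does not have \<open>S\<close> as a member.\<close>

lemma nested_insert_old: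
  assumes N: "S \<notin> N"
  shows "nested (insert S B) V N \<longleftrightarrow> nested B V N \<and> \<not> singletons S \<subseteq> N"
proof
  assume n: "nested (insert S B) V N"
  have "S \<notin> singletons S" using two unfolding singletons_def by blast
  then have "\<not> singletons S \<subseteq> N" using nestedD[OF n, of "singletons S"] by auto
  moreover have "nested B V N" using n N unfolding nested_def by blast
  ultimately show "nested B V N \<and> \<not> singletons S \<subseteq> N" by blast
next
  assume n: "nested B V N \<and> \<not> singletons S \<subseteq> N"
  have "\<Union>M \<in> M" if M: "M \<subseteq> N" "\<Union>M \<in> insert S B" for M
  proof (cases "\<Union>M = S")
    case True
    have MB: "s \<in> B" if "s \<in> M" for s using n M(1) nested_in that by blast
    then have "s \<in> singletons S" if "s \<in> M" for s
      using that True ne Bsub[of s] by blast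
    moreover have "{v} \<in> M" if v: "v \<in> S" for v
    proof -
      obtain s where s: "s \<in> M" "v \<in> s" using v True by blast
      then have "s \<in> singletons S" using \<open>\<And>s. s \<in> M \<Longrightarrow> s \<in> singletons S\<close> by blast
      then have "s = {v}" using s(2) unfolding singletons_def by auto
      then show ?thesis using s(1) by simp
    qed
    ultimately have "singletons S \<subseteq> M" unfolding singletons_def by blast
    then show ?thesis using n M(1) by blast
  next
    case False
    then show ?thesis using nestedD[of B V N M] n M by blast
  qed
  moreover have "N \<subseteq> insert S B - {V}" using n unfolding nested_def by blast
  ultimately show "nested (insert S B) V N" unfolding nested_def by blast
qed

text \<open>The set \<open>S\<close> and the family \<open>singletons S\<close> have the same union,
  so each direction trades one for the other inside a subfamily.\<close>

lemma nested_insert_new: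
  assumes N: "S \<notin> N"
  shows "nested (insert S B) V (insert S N) \<longleftrightarrow>
    nested B V N \<and> \<not> singletons S \<subseteq> N \<and> nested B V (N \<union> singletons S)"
proof
  assume n: "nested (insert S B) V (insert S N)"
  then have n0: "nested B V N \<and> \<not> singletons S \<subseteq> N"
    using nested_insert_old[OF N] nested_subset[OF n, of N] by blast
  have "\<Union>M \<in> M" if M: "M \<subseteq> N \<union> singletons S" "\<Union>M \<in> B" for M
  proof (cases "M \<subseteq> N")
    case True
    then show ?thesis using n0 nestedD M(2) by blast
  next
    case False
    then obtain v where v: "v \<in> S" "{v} \<in> M" using M(1) unfolding singletons_def by blast
    then have meet: "\<Union>M \<inter> S \<noteq> {}" by blast
    consider "\<Union>M \<in> singletons S" | "\<Union>M \<union> S \<in> B" using un[OF M(2) meet] by blast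
    then show ?thesis
    proof cases
      case 1
      then obtain w where "\<Union>M = {w}" unfolding singletons_def by blast
      then show ?thesis using v by auto
    next
      case 2
      \<comment> \<open>The members of \<open>M\<close> outside \<open>N\<close> are singletons of
        \<open>S\<close>, and \<open>S\<close> replaces them. The greatest member of the new family
        is not \<open>S\<close>, since its union lies in \<open>B\<close>; so it is already in
        \<open>M\<close> and contains all of \<open>M\<close>.\<close>
      let ?M = "insert S (M \<inter> N)"
      have e: "\<Union>?M = \<Union>M \<union> S"
      proof -
        have "x \<in> S \<union> \<Union>(M \<inter> N)" if "x \<in> s" "s \<in> M" for x s
          using that M(1) unfolding singletons_def by auto
        then show ?thesis by auto
      qed
      have "\<Union>?M \<in> ?M" by (rule nestedD[OF n]) (use 2 e in auto)
      moreover have "\<Union>?M \<noteq> S" using 2 e S(1) by metis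
      ultimately have "\<Union>?M \<in> M" by blast
      moreover from this have "\<Union>?M = \<Union>M" using e by blast
      ultimately show ?thesis by simp
    qed
  qed
  moreover have "N \<union> singletons S \<subseteq> B - {V}"
    using n0 single unfolding nested_def singletons_def by blast
  ultimately have "nested B V (N \<union> singletons S)" unfolding nested_def by blast
  with n0 show "nested B V N \<and> \<not> singletons S \<subseteq> N \<and> nested B V (N \<union> singletons S)" by blast
next
  assume n: "nested B V N \<and> \<not> singletons S \<subseteq> N \<and> nested B V (N \<union> singletons S)"
  then have n0: "nested (insert S B) V N" using nested_insert_old[OF N] by blast
  have "\<Union>M \<in> M" if M: "M \<subseteq> insert S N" "\<Union>M \<in> insert S B" for M
  proof (cases "S \<in> M")
    case False
    then show ?thesis using nestedD[OF n0] M by blast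
  next
    case True
    show ?thesis
    proof (cases "\<Union>M = S")
      case False
      \<comment> \<open>This exchange keeps the union, and the greatest member cannot be a singleton
        of \<open>S\<close>, because the union contains \<open>S\<close>.\<close>
      let ?M = "(M - {S}) \<union> singletons S"
      have "insert S (M - {S}) = M" using True by blast
      then have "\<Union>M = S \<union> \<Union>(M - {S})" by (metis Union_insert)
      then have e: "\<Union>?M = \<Union>M" by (simp add: Un_commute)
      have "?M \<subseteq> N \<union> singletons S" using M(1) by blast
      then have "\<Union>?M \<in> ?M" using n nestedD[of B V _ ?M] M(2) False e by auto
      moreover have "\<Union>M \<notin> singletons S"
      proof
        assume "\<Union>M \<in> singletons S"
        then obtain v where v: "v \<in> S" "\<Union>M = {v}" unfolding singletons_def by blast
        then have "S = {v}" using True by blast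
        then show False using two by blast
      qed
      ultimately show ?thesis using e by auto
    qed (use True in simp)
  qed
  moreover have "insert S N \<subseteq> insert S B - {V}" using n S unfolding nested_def by blast
  ultimately show "nested (insert S B) V (insert S N)" unfolding nested_def by blast
qed

end

section \<open>Connectivity in terms of cuts\<close>

text \<open>Symmetrised because the library's \<open>connected\<close> refers to the underlying
  undirected graph.\<close>

definition adj :: "('v, 'e) pre_digraph \<Rightarrow> 'v \<Rightarrow> 'v \<Rightarrow> bool" where
  "adj \<Gamma> a b \<longleftrightarrow> (a, b) \<in> (arcs_ends \<Gamma>)\<^sup>s"

lemma adj_sym: "adj \<Gamma> a b \<Longrightarrow> adj \<Gamma> b a"
  unfolding adj_def symcl_def by auto

lemma adj_induce: "adj (\<Gamma> \<restriction> s) a b \<longleftrightarrow> adj \<Gamma> a b \<and> a \<in> s \<and> b \<in> s"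
  unfolding adj_def symcl_def arcs_ends_conv by auto

definition conn :: "('v, 'e) pre_digraph \<Rightarrow> 'v set \<Rightarrow> bool" where
  "conn \<Gamma> s \<longleftrightarrow> Digraph_Component.connected (\<Gamma> \<restriction> s)"

text \<open>If the set reachable from a node were not everything, it would be a cut without edges.
  Later arguments choose cuts instead of building paths.\<close>

lemma conn_cut:
  "conn \<Gamma> s \<longleftrightarrow> s \<noteq> {} \<and> (\<forall>A\<subseteq>s. A \<noteq> {} \<longrightarrow> A \<noteq> s \<longrightarrow> (\<exists>a\<in>A. \<exists>b\<in>s - A. adj \<Gamma> a b))"
  (is "_ \<longleftrightarrow> ?R")
proof
  let ?E = "(arcs_ends (\<Gamma> \<restriction> s))\<^sup>s"
  assume "conn \<Gamma> s"
  then have c: "s \<noteq> {}" "\<And>u v. u \<in> s \<Longrightarrow> v \<in> s \<Longrightarrow> (u, v) \<in> rtrancl_on s ?E"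
    unfolding conn_def connected_conv by auto
  have "\<exists>a\<in>A. \<exists>b\<in>s - A. adj \<Gamma> a b" if A: "A \<subseteq> s" "A \<noteq> {}" "A \<noteq> s" for A
  proof (rule ccontr)
    assume none: "\<not> ?thesis"
    obtain u v where u: "u \<in> A" and v: "v \<in> s - A" using A by blast
    have "w \<in> A" if "(u, w) \<in> rtrancl_on s ?E" for w
      using that
    proof (induction rule: rtrancl_on_induct)
      case (step x y)
      then have "adj (\<Gamma> \<restriction> s) x y" unfolding adj_def by simp
      then show ?case using none step unfolding adj_induce by blast
    qed (use u in simp)
    then show False using c(2)[of u v] u v A by blast
  qed
  then show ?R using c(1) by blast
next
  let ?E = "(arcs_ends (\<Gamma> \<restriction> s))\<^sup>s"
  assume R: ?R
  have "(u, v) \<in> rtrancl_on s ?E" if u: "u \<in> s" and v: "v \<in> s" for u v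
  proof -
    define A where "A = {w. (u, w) \<in> rtrancl_on s ?E}"
    have "A = s"
    proof (rule ccontr)
      assume "A \<noteq> s"
      moreover have "A \<subseteq> s"
      proof
        fix w assume "w \<in> A"
        then have "(u, w) \<in> rtrancl_on s ?E" unfolding A_def by simp
        then show "w \<in> s" by (induction rule: rtrancl_on_induct) (use u in auto)
      qed
      moreover have "u \<in> A" using u unfolding A_def by simp
      ultimately obtain a b where ab: "a \<in> A" "b \<in> s - A" "adj \<Gamma> a b" using R by blast
      then have "adj (\<Gamma> \<restriction> s) a b" unfolding adj_induce using \<open>A \<subseteq> s\<close> by blast
      then have "(u, b) \<in> rtrancl_on s ?E"
        using ab unfolding A_def adj_def by (auto intro: rtrancl_on_into_rtrancl_on)
      then show False using ab unfolding A_def by blast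
    qed
    then show ?thesis using v unfolding A_def by blast
  qed
  then show "conn \<Gamma> s" using R unfolding conn_def connected_conv by auto
qed

lemma conn_cutD:
  assumes "conn \<Gamma> s" "A \<subseteq> s" "A \<noteq> {}" "A \<noteq> s"
  obtains a b where "a \<in> A" "b \<in> s - A" "adj \<Gamma> a b"
  using assms unfolding conn_cut by blast

lemma conn_nonempty: "conn \<Gamma> s \<Longrightarrow> s \<noteq> {}"
  unfolding conn_cut by blast

text \<open>Holds for every \<open>v\<close>, also outside \<open>verts \<Gamma>\<close>: the vertex
  set of \<open>\<Gamma> \<restriction> s\<close> is \<open>s\<close> itself.\<close>

lemma conn_singleton: "conn \<Gamma> {v}"
  unfolding conn_cut by blast

text \<open>A cut of \<open>s \<union> t\<close> splits \<open>s\<close> or \<open>t\<close>;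
  otherwise it would contain one and miss the other, against the common node.\<close>

lemma conn_Un:
  assumes s: "conn \<Gamma> s" and t: "conn \<Gamma> t" and st: "s \<inter> t \<noteq> {}"
  shows "conn \<Gamma> (s \<union> t)"
  unfolding conn_cut
proof (intro conjI allI impI)
  fix A assume A: "A \<subseteq> s \<union> t" "A \<noteq> {}" "A \<noteq> s \<union> t"
  have cut: "\<exists>a\<in>A. \<exists>b\<in>s \<union> t - A. adj \<Gamma> a b"
    if r: "conn \<Gamma> r" "r \<subseteq> s \<union> t" "A \<inter> r \<noteq> {}" "A \<inter> r \<noteq> r" for r
    using conn_cutD[OF r(1) _ r(3,4)] r(2) by blast
  have "A \<inter> s \<noteq> {} \<and> A \<inter> s \<noteq> s \<or> A \<inter> t \<noteq> {} \<and> A \<inter> t \<noteq> t"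
    using A st by blast
  then show "\<exists>a\<in>A. \<exists>b\<in>s \<union> t - A. adj \<Gamma> a b" using cut[OF s] cut[OF t] by blast
qed (use conn_nonempty[OF s] in blast)

lemma conn_pair: "a \<noteq> b \<Longrightarrow> conn \<Gamma> {a, b} \<longleftrightarrow> adj \<Gamma> a b"
proof
  assume "a \<noteq> b" "conn \<Gamma> {a, b}"
  then obtain x y where "x \<in> {a}" "y \<in> {a,b} - {a}" "adj \<Gamma> x y"
    using conn_cutD[of \<Gamma> "{a,b}" "{a}"] by blast
  then show "adj \<Gamma> a b" by auto
next
  assume "a \<noteq> b" "adj \<Gamma> a b"
  moreover from this(2) have "adj \<Gamma> b a" by (rule adj_sym)
  moreover have "A = {a} \<or> A = {b}" if "A \<subseteq> {a, b}" "A \<noteq> {}" "A \<noteq> {a, b}" for A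
    using that by blast
  ultimately show "conn \<Gamma> {a, b}" unfolding conn_cut using \<open>a \<noteq> b\<close> by blast
qed

lemma conn_insert:
  assumes "conn \<Gamma> t" "b \<in> t" "adj \<Gamma> a b"
  shows "conn \<Gamma> (insert a t)"
proof (cases "a = b")
  case True
  then show ?thesis using assms by (simp add: insert_absorb)
next
  case False
  then have "conn \<Gamma> ({a, b} \<union> t)" using assms by (intro conn_Un) (auto simp: conn_pair)
  then show ?thesis using assms by (simp add: insert_absorb)
qed

lemma conn_induce: "s \<subseteq> t \<Longrightarrow> conn (\<Gamma> \<restriction> t) s \<longleftrightarrow> conn \<Gamma> s"
  unfolding conn_cut adj_induce by blast

lemma tube_conn: "tube \<Gamma> t \<longleftrightarrow> t \<subset> verts \<Gamma> \<and> conn \<Gamma> t"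
  unfolding tube_def conn_def[symmetric] using conn_nonempty by blast

section \<open>Connectivity in the reconnected complement\<close>

lemma verts_reconnected_complement [simp]: "verts (reconnected_complement \<Gamma> t) = verts \<Gamma> - t"
  unfolding reconnected_complement_def by simp

lemma adj_reconnected_complement:
  "adj (reconnected_complement \<Gamma> t) a b \<longleftrightarrow> a \<in> verts \<Gamma> - t \<and> b \<in> verts \<Gamma> - t \<and> a \<noteq> b \<and>
     (adj \<Gamma> a b \<or> conn \<Gamma> ({a, b} \<union> t))"
  unfolding reconnected_complement_def adj_def symcl_def conn_def[symmetric]
  using conn_pair[of a b \<Gamma>] by (auto simp: conn_pair insert_commute adj_def symcl_def)

text \<open>An edge that is new in the complement joins two nodes that both touch \<open>t\<close>.
  If \<open>s\<close> is connected in the complement but \<open>s \<union> t\<close> is not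
  connected, then no node of \<open>s\<close> touches \<open>t\<close>, and both graphs have the
  same edges on \<open>s\<close>.\<close>

lemma conn_reconnected_complement:
  assumes t: "conn \<Gamma> t" and s: "s \<subseteq> verts \<Gamma> - t" "s \<noteq> {}"
  shows "conn (reconnected_complement \<Gamma> t) s \<longleftrightarrow> conn \<Gamma> s \<or> conn \<Gamma> (s \<union> t)"
proof
  let ?adj = "adj (reconnected_complement \<Gamma> t)"
  assume c: "conn (reconnected_complement \<Gamma> t) s"
  show "conn \<Gamma> s \<or> conn \<Gamma> (s \<union> t)"
  proof (rule disjCI)
    assume "\<not> conn \<Gamma> (s \<union> t)"
    then obtain C where C: "C \<subseteq> s \<union> t" "C \<noteq> {}" "C \<noteq> s \<union> t"
      and noC: "\<And>a b. a \<in> C \<Longrightarrow> b \<in> s \<union> t - C \<Longrightarrow> \<not> adj \<Gamma> a b"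
      using s unfolding conn_cut by blast
    \<comment> \<open>The connected set \<open>t\<close> lies on one side of the cut, so the other
      side \<open>D\<close> is a part of \<open>s\<close> without edges to the rest.\<close>
    have "t \<subseteq> C \<or> t \<inter> C = {}"
    proof (rule ccontr)
      assume "\<not> ?thesis"
      then obtain a b where "a \<in> C \<inter> t" "b \<in> t - C \<inter> t" "adj \<Gamma> a b"
        using conn_cutD[OF t, of "C \<inter> t"] by blast
      then show False using noC[of a b] by blast
    qed
    then obtain D where D: "D \<subseteq> s" "D \<noteq> {}" and noD: "\<And>a b. a \<in> D \<Longrightarrow> b \<in> s \<union> t - D \<Longrightarrow> \<not> adj \<Gamma> a b"
    proof
      assume "t \<subseteq> C"
      then show ?thesis using C noC adj_sym[of \<Gamma>] by (intro that[of "s \<union> t - C"]) blast+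
    next
      assume "t \<inter> C = {}"
      then show ?thesis using C noC by (intro that[of C]) blast+
    qed
    \<comment> \<open>The cut \<open>{d}\<close> would give an edge leaving \<open>D\<close>; so no
      new edge joins \<open>D\<close> to \<open>s - D\<close> either.\<close>
    have noE: "\<not> conn \<Gamma> ({d, c} \<union> t)" if d: "d \<in> D" and c: "c \<in> s - D" for c d
    proof
      assume "conn \<Gamma> ({d, c} \<union> t)"
      moreover have "d \<notin> t" "d \<noteq> c" using d c D s by auto
      ultimately obtain b where "b \<in> insert c t" "adj \<Gamma> d b"
        using conn_cutD[of \<Gamma> "{d, c} \<union> t" "{d}"] by auto
      then show False using noD[of d b] d c D s by blast
    qed
    have "D = s"
    proof (rule ccontr)
      assume "D \<noteq> s"
      then obtain d c where dc: "d \<in> D" "c \<in> s - D" "?adj d c" using conn_cutD[OF c D(1,2)] by blast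
      then show False using noE noD unfolding adj_reconnected_complement by blast
    qed
    \<comment> \<open>Now \<open>D = s\<close> has no edge to \<open>t\<close>, whereas an edge that
      is new in the complement would require one.\<close>
    have "adj \<Gamma> a b" if ab: "?adj a b" "a \<in> s" "b \<in> s" for a b
    proof (rule ccontr)
      assume "\<not> adj \<Gamma> a b"
      then have "conn \<Gamma> ({a, b} \<union> t)" using ab unfolding adj_reconnected_complement by blast
      moreover obtain z where "z \<in> t" using conn_nonempty[OF t] by blast
      moreover have "z \<noteq> a" "z \<noteq> b" using \<open>z \<in> t\<close> ab s by auto
      then have "{a, b} \<noteq> {a, b} \<union> t" using \<open>z \<in> t\<close> by auto
      ultimately obtain x y where "x \<in> {a, b}" "y \<in> {a, b} \<union> t - {a, b}" "adj \<Gamma> x y"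
        using conn_cutD[of \<Gamma> "{a, b} \<union> t" "{a, b}"] by (metis Un_upper1 insert_not_empty)
      then have "x \<in> {a, b}" "y \<in> t" "adj \<Gamma> x y" by blast+
      then show False using noD[of x y] \<open>D = s\<close> ab s by blast
    qed
    then show "conn \<Gamma> s" using c unfolding conn_cut by (meson DiffD1 subsetD)
  qed
next
  let ?adj = "adj (reconnected_complement \<Gamma> t)"
  have sub: "?adj a b" if "adj \<Gamma> a b" "a \<in> s" "b \<in> s" "a \<noteq> b" for a b
    using that s unfolding adj_reconnected_complement by blast
  assume "conn \<Gamma> s \<or> conn \<Gamma> (s \<union> t)"
  then show "conn (reconnected_complement \<Gamma> t) s"
  proof
    assume c: "conn \<Gamma> s"
    show ?thesis unfolding conn_cut
    proof (intro conjI allI impI)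
      fix A assume A: "A \<subseteq> s" "A \<noteq> {}" "A \<noteq> s"
      then obtain a b where "a \<in> A" "b \<in> s - A" "adj \<Gamma> a b" using conn_cutD[OF c] by blast
      then show "\<exists>a\<in>A. \<exists>b\<in>s - A. ?adj a b" using sub A by blast
    qed (use s in simp)
  next
    assume c: "conn \<Gamma> (s \<union> t)"
    show ?thesis unfolding conn_cut
    proof (intro conjI allI impI)
      fix A assume A: "A \<subseteq> s" "A \<noteq> {}" "A \<noteq> s"
      show "\<exists>a\<in>A. \<exists>b\<in>s - A. ?adj a b"
      proof (cases "\<exists>a\<in>A. \<exists>b\<in>s - A. adj \<Gamma> a b")
        case True
        then show ?thesis using sub A by blast
      next
        case False
        have tne: "t \<noteq> {}" "t \<inter> s = {}" using conn_nonempty[OF t] s by auto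
        \<comment> \<open>With no edge between \<open>A\<close> and \<open>s - A\<close>, the cuts
          \<open>A\<close> and \<open>A \<union> t\<close> force edges from \<open>A\<close> to
          \<open>t\<close> and from \<open>t\<close> to \<open>s - A\<close>; their ends outside
          \<open>t\<close> are joined in the complement.\<close>
        have "A \<noteq> s \<union> t" "A \<union> t \<noteq> s \<union> t" "A \<union> t \<subseteq> s \<union> t" "A \<union> t \<noteq> {}" "A \<subseteq> s \<union> t"
          using A tne by blast+
        then obtain a x b y where 1: "a \<in> A" "x \<in> s \<union> t - A" "adj \<Gamma> a x"
          and 2: "y \<in> A \<union> t" "b \<in> s \<union> t - (A \<union> t)" "adj \<Gamma> y b"
          using conn_cutD[OF c, of A] conn_cutD[OF c, of "A \<union> t"] A(2) by metis
        have x: "x \<in> t" and y: "y \<in> t" and b: "b \<in> s - A" using 1 2 False by blast+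
        have "conn \<Gamma> (insert a (insert b t))"
          using conn_insert[OF conn_insert[OF t y], of b a x] adj_sym[OF 2(3)] x 1
          by (metis conn_insert insertI2 t y)
        then have "?adj a b" using 1 b A s unfolding adj_reconnected_complement by auto
        then show ?thesis using 1 b by blast
      qed
    qed (use s in simp)
  qed
qed

section \<open>Active constraints and truncation\<close>

definition affine_form :: "('a::euclidean_space \<Rightarrow> real) \<Rightarrow> bool" where
  "affine_form h \<longleftrightarrow> (\<exists>a c. \<forall>x. h x = a \<bullet> x + c)"

lemma affine_form_line:
  assumes "affine_form h"
  shows "h (x + u *\<^sub>R (y - x)) = h x + u * (h y - h x)"
  using assms unfolding affine_form_def by (auto simp: inner_simps algebra_simps)

lemma affine_form_convex_comb:
  assumes "affine_form h" "u + v = 1"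
  shows "h (u *\<^sub>R x + v *\<^sub>R y) = u * h x + v * h y"
proof -
  have "u = 1 - v" using assms by simp
  then have e: "u *\<^sub>R x + v *\<^sub>R y = x + v *\<^sub>R (y - x)" by (simp only:) (simp add: algebra_simps)
  have "h (u *\<^sub>R x + v *\<^sub>R y) = h x + v * (h y - h x)"
    unfolding e by (rule affine_form_line[OF assms(1)])
  also have "\<dots> = u * h x + v * h y" using \<open>u = 1 - v\<close> by (simp only:) (simp add: algebra_simps)
  finally show ?thesis .
qed

lemma affine_form_closed: "affine_form h \<Longrightarrow> closed {x. 0 \<le> h x}"
  unfolding affine_form_def
  by (auto intro!: closed_Collect_le continuous_intros)

lemma affine_form_convex:
  assumes "affine_form h"
  shows "convex {x. 0 \<le> h x}" "convex {x. h x < 0}"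
proof -
  obtain a c where "\<And>x. h x = a \<bullet> x + c" using assms unfolding affine_form_def by blast
  then have "{x. 0 \<le> h x} = {x. a \<bullet> x \<ge> - c}" "{x. h x < 0} = {x. a \<bullet> x < - c}" by auto
  then show "convex {x. 0 \<le> h x}" "convex {x. h x < 0}"
    by (simp_all add: convex_halfspace_ge convex_halfspace_lt)
qed

lemma affine_form_uminus: "affine_form h \<Longrightarrow> affine_form (\<lambda>x. - h x)"
  unfolding affine_form_def
    by (metis add.commute diff_conv_add_uminus inner_minus_left minus_add_distrib)

text \<open>If \<open>h\<close> were negative at all extreme points, it would be negative on their
  hull, which is \<open>C\<close> by Krein-Milman. This carries conditions on vertices over to whole
  faces.\<close>

lemma exists_extreme_ge:
  assumes "compact C" "convex C" "affine_form h" "x \<in> C" "h x \<ge> 0"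
  shows "\<exists>v. v extreme_point_of C \<and> h v \<ge> 0"
proof (rule ccontr)
  assume "\<not> ?thesis"
  then have "{v. v extreme_point_of C} \<subseteq> {x. h x < 0}" by auto
  then have "convex hull {v. v extreme_point_of C} \<subseteq> {x. h x < 0}"
    using hull_minimal affine_form_convex(2)[OF assms(3)] by metis
  then show False using Krein_Milman_Minkowski[OF assms(1,2)] assms(4,5) by auto
qed

definition active :: "'i set \<Rightarrow> ('i \<Rightarrow> 'a \<Rightarrow> real) \<Rightarrow> 'a \<Rightarrow> 'i set" where
  "active I g x = {i \<in> I. g i x = 0}"

definition active_face :: "'a set \<Rightarrow> 'i set \<Rightarrow> ('i \<Rightarrow> 'a \<Rightarrow> real) \<Rightarrow> 'i set \<Rightarrow> 'a set" where
  "active_face P I g S = {x \<in> P. S \<subseteq> active I g x}"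

lemma active_face_face_of:
  assumes "convex P" and g: "\<And>i. i \<in> I \<Longrightarrow> affine_form (g i)"
    and P: "\<And>i x. i \<in> I \<Longrightarrow> x \<in> P \<Longrightarrow> g i x \<ge> 0" and S: "S \<subseteq> I"
  shows "active_face P I g S face_of P"
  unfolding face_of_def
proof (intro conjI ballI impI)
  show "active_face P I g S \<subseteq> P" unfolding active_face_def by blast
  show "convex (active_face P I g S)"
    unfolding convex_def
  proof (intro ballI allI impI)
    fix x y u v assume "x \<in> active_face P I g S" "y \<in> active_face P I g S" "0 \<le> u" "0 \<le> v" "u + v = (1::real)"
    moreover from this have "u *\<^sub>R x + v *\<^sub>R y \<in> P"
      using \<open>convex P\<close> unfolding active_face_def by (auto intro: convexD)
    ultimately show "u *\<^sub>R x + v *\<^sub>R y \<in> active_face P I g S"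
      using S g by (force simp: active_face_def active_def affine_form_convex_comb)
  qed
  fix a b x assume ab: "a \<in> P" "b \<in> P" "x \<in> active_face P I g S" "x \<in> open_segment a b"
  then obtain u where u: "0 < u" "u < 1" "x = (1 - u) *\<^sub>R a + u *\<^sub>R b"
    by (auto simp: in_segment)
  have "g i a = 0 \<and> g i b = 0" if i: "i \<in> S" for i
  proof -
    have "i \<in> I" using i S by blast
    then have "g i x = (1 - u) * g i a + u * g i b" using g u by (simp add: affine_form_convex_comb)
    moreover have "g i x = 0" using ab(3) i unfolding active_face_def active_def by blast
    moreover have "g i a \<ge> 0" "g i b \<ge> 0" using P \<open>i \<in> I\<close> ab by auto
    ultimately show ?thesis using u
      by (smt (verit, best) mult_nonneg_nonneg mult_pos_pos)
  qed
  then show "a \<in> active_face P I g S" "b \<in> active_face P I g S"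
    using S ab unfolding active_face_def active_def by auto
qed

lemma convex_comb_eq_0_iff:
  fixes a b u :: real
  assumes "0 \<le> a" "0 \<le> b" "0 < u" "u < 1"
  shows "(1 - u) * a + u * b = 0 \<longleftrightarrow> a = 0 \<and> b = 0"
  using assms by (simp add: add_nonneg_eq_0_iff)

text \<open>Whether the new hyperplane meets the points with active set exactly \<open>X\<close> is
  decided by the signs of \<open>g n\<close> at the vertices of \<open>active_face P I g X\<close>.
  Vertices in the cut face are negative and all others positive, so the two conditions on
  \<open>X\<close> provide a vertex of each sign.\<close>

lemma truncation_step:
  fixes g :: "'i \<Rightarrow> 'a::euclidean_space \<Rightarrow> real"
  assumes P: "compact P" "convex P" and g: "\<And>i. i \<in> I \<Longrightarrow> affine_form (g i)"
    and pos: "\<And>i x. i \<in> I \<Longrightarrow> x \<in> P \<Longrightarrow> g i x \<ge> 0"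
    and n: "n \<notin> I" and S: "S \<subseteq> I" and h: "affine_form (g n)"
    and down: "\<And>X Y. X \<in> active I g ` P \<Longrightarrow> Y \<subseteq> X \<Longrightarrow> Y \<in> active I g ` P"
    and cut: "\<And>v. v extreme_point_of P \<Longrightarrow> (0 \<le> g n v \<longleftrightarrow> v \<notin> active_face P I g S) \<and> g n v \<noteq> 0"
  shows "active (insert n I) g ` {x \<in> P. 0 \<le> g n x} =
    {X \<in> active I g ` P. \<not> S \<subseteq> X} \<union>
    insert n ` {X \<in> active I g ` P. \<not> S \<subseteq> X \<and> X \<union> S \<in> active I g ` P}" (is "?L = ?A \<union> ?B")
proof -
  let ?a = "active I g" and ?f = "active_face P I g"
  have act: "active (insert n I) g x = (if g n x = 0 then insert n (?a x) else ?a x)" for x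
    unfolding active_def by auto
  have face: "?f T face_of P" if "T \<subseteq> I" for T
    using active_face_face_of[OF P(2)] g pos that by blast
  have cc: "compact (?f T)" "convex (?f T)" if "T \<subseteq> I" for T
    using face_of_imp_compact[OF P(2,1) face[OF that]] face_of_imp_convex[OF face[OF that]] P
      by auto
  have ext: "v extreme_point_of ?f T \<longleftrightarrow> v extreme_point_of P \<and> v \<in> ?f T" if "T \<subseteq> I" for v T
    using extreme_point_of_face[OF face[OF that]] .
  have aI: "?a x \<subseteq> I" for x unfolding active_def by blast
  have self: "x \<in> ?f (?a x)" if "x \<in> P" for x using that unfolding active_face_def by blast
  \<comment> \<open>All vertices of the cut face are negative, hence so are all its points.\<close>
  have notS: "\<not> S \<subseteq> ?a x" if x: "x \<in> P" "0 \<le> g n x" for x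
  proof
    assume "S \<subseteq> ?a x"
    then have "x \<in> ?f S" using x unfolding active_face_def by blast
    then obtain v where "v extreme_point_of ?f S" "g n v \<ge> 0"
      using exists_extreme_ge[OF cc[OF S] h] x by blast
    then show False using ext[OF S] cut by blast
  qed
  \<comment> \<open>A vertex of \<open>?f (?a x)\<close> on the nonpositive side belongs to the cut
    face. All of \<open>?a x \<union> S\<close> is active there, and \<open>down\<close> cuts its
    active set back to that union.\<close>
  have meetS: "?a x \<union> S \<in> ?a ` P" if x: "x \<in> P" "g n x \<le> 0" for x
  proof -
    obtain v where v: "v extreme_point_of ?f (?a x)" "g n v \<le> 0"
      using exists_extreme_ge[OF cc[OF aI] affine_form_uminus[OF h] self[OF x(1)]] x by auto
    then have v': "v extreme_point_of P" "v \<in> ?f (?a x)" using ext[OF aI] by auto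
    then have "v \<in> ?f S" using cut v(2) by force
    then have "?a x \<union> S \<subseteq> ?a v" "v \<in> P" using v' unfolding active_face_def by auto
    then show ?thesis using down by blast
  qed
  \<comment> \<open>Moving from \<open>w\<close> a little towards \<open>y\<close> leaves exactly
    the constraints of \<open>y\<close> active, while \<open>g n\<close> keeps the sign it has at
    \<open>w\<close>.\<close>
  have near: "\<exists>x\<in>P. ?a x = ?a y \<and> g n x * g n w > 0"
    if y: "y \<in> P" and w: "w \<in> ?f (?a y)" and gw: "g n w \<noteq> 0" for y w
  proof -
    define M where "M = \<bar>g n y\<bar> + \<bar>g n w\<bar> + 1"
    \<comment> \<open>With this step length \<open>g n\<close> changes by at most half of its
      absolute value at \<open>w\<close>; the summands of \<open>M\<close> also give
      \<open>u < 1\<close>.\<close>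
    define u where "u = \<bar>g n w\<bar> / (2 * M)"
    have M: "M > 0" "\<bar>g n w\<bar> < M" "\<bar>g n y - g n w\<bar> < M" unfolding M_def by auto
    then have u: "0 < u" "u < 1" using gw unfolding u_def by (auto simp: field_simps)
    define x where "x = w + u *\<^sub>R (y - w)"
    have xc: "x = (1 - u) *\<^sub>R w + u *\<^sub>R y" unfolding x_def by (simp add: algebra_simps)
    have wP: "w \<in> P" using w unfolding active_face_def by blast
    have "x \<in> P" unfolding xc using u y wP by (intro convexD[OF P(2)]) auto
    moreover have "?a x = ?a y"
    proof -
      have "g i x = 0 \<longleftrightarrow> g i y = 0" if i: "i \<in> I" for i
      proof -
        have e: "g i x = (1 - u) * g i w + u * g i y" unfolding xc using g[OF i]
          by (simp add: affine_form_convex_comb)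
        have nn: "g i w \<ge> 0" "g i y \<ge> 0" using pos[OF i] y wP by auto
        have "g i y = 0 \<Longrightarrow> g i w = 0" using w i unfolding active_face_def active_def by blast
        then show ?thesis using convex_comb_eq_0_iff[OF nn u] unfolding e by blast
      qed
      then show ?thesis unfolding active_def by blast
    qed
    moreover have "g n x * g n w > 0"
    proof -
      have e: "g n x = g n w + u * (g n y - g n w)" unfolding x_def by (rule affine_form_line[OF h])
      have "\<bar>u * (g n y - g n w)\<bar> \<le> u * M" using M u by (simp add: abs_mult)
      also have "\<dots> = \<bar>g n w\<bar> / 2" unfolding u_def using M by simp
      finally have "\<bar>u * (g n y - g n w)\<bar> < \<bar>g n w\<bar>" using gw by simp
      then show ?thesis unfolding e by (smt (verit) zero_less_mult_iff)
    qed
    ultimately show ?thesis by blast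
  qed
  \<comment> \<open>The face of \<open>X\<close> is the hull of its vertices and does not lie in the
    cut face, so one of its vertices is positive.\<close>
  have up: "\<exists>x\<in>P. ?a x = X \<and> g n x > 0" if X: "X \<in> ?a ` P" "\<not> S \<subseteq> X" for X
  proof -
    obtain y where y: "y \<in> P" "X = ?a y" using X(1) by blast
    have "\<not> ?f X \<subseteq> ?f S" using y X(2) self[OF y(1)] unfolding active_face_def by blast
    then have "\<not> {v. v extreme_point_of ?f X} \<subseteq> ?f S"
      using Krein_Milman_Minkowski[OF cc[OF aI[of y]]] hull_minimal[of _ "?f S" convex] cc(2)[OF S] y(2) by metis
    then obtain w where w: "w extreme_point_of ?f X" "w \<notin> ?f S" by blast
    then have "w \<in> ?f (?a y)" "g n w > 0" using ext[OF aI[of y]] cut[of w] y(2) by auto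
    then obtain x where "x \<in> P" "?a x = ?a y" "g n x * g n w > 0" using near[OF y(1), of w] by auto
    then show ?thesis using \<open>g n w > 0\<close> y(2) by (auto simp: zero_less_mult_iff)
  qed
  \<comment> \<open>Any vertex of the face of \<open>X \<union> S\<close> lies in the cut face and
    is therefore negative.\<close>
  have dn: "\<exists>x\<in>P. ?a x = X \<and> g n x < 0" if X: "X \<in> ?a ` P" "X \<union> S \<in> ?a ` P" for X
  proof -
    obtain y where y: "y \<in> P" "X = ?a y" using X(1) by blast
    have XS: "X \<union> S \<subseteq> I" using X(2) aI by blast
    obtain x where "x \<in> P" "X \<union> S = ?a x" using X(2) by blast
    then have "?f (X \<union> S) \<noteq> {}" using self[of x] by auto
    then obtain w where w: "w extreme_point_of ?f (X \<union> S)"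
      using extreme_point_exists_convex cc[OF XS] by blast
    then have w': "w extreme_point_of P" "w \<in> ?f (X \<union> S)" using ext[OF XS] by auto
    then have "w \<in> ?f S" "w \<in> ?f X" unfolding active_face_def by auto
    then have "w \<in> ?f (?a y)" "g n w < 0" using cut[OF w'(1)] y(2) by auto
    then obtain x where "x \<in> P" "?a x = ?a y" "g n x * g n w > 0" using near[OF y(1), of w] by auto
    then show ?thesis using \<open>g n w < 0\<close> y(2) by (auto simp: zero_less_mult_iff)
  qed
  have 1: "X \<in> ?A \<union> ?B" if X: "X \<in> ?L" for X
  proof -
    obtain x where x: "x \<in> P" "0 \<le> g n x" "X = active (insert n I) g x" using X by blast
    show ?thesis
    proof (cases "g n x = 0")
      case True
      then show ?thesis using x act notS meetS by force
    next
      case False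
      then show ?thesis using x act notS by force
    qed
  qed
  have 2: "X \<in> ?L" if X: "X \<in> ?A" for X
  proof -
    obtain x where x: "x \<in> P" "?a x = X" "g n x > 0" using up[of X] X by auto
    then have "X = active (insert n I) g x" using act by simp
    then show ?thesis using x by auto
  qed
  have 3: "insert n X \<in> ?L" if X: "X \<in> ?a ` P" "\<not> S \<subseteq> X" "X \<union> S \<in> ?a ` P" for X
  proof -
    obtain x y where x: "x \<in> P" "?a x = X" "g n x > 0" and y: "y \<in> P" "?a y = X" "g n y < 0"
      using up[OF X(1,2)] dn[OF X(1,3)] by auto
    \<comment> \<open>The zero of \<open>g n\<close> on the segment from \<open>x\<close> to
      \<open>y\<close>.\<close>
    define u where "u = g n x / (g n x - g n y)"
    have u: "0 < u" "u < 1" unfolding u_def using x y by (auto simp: field_simps)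
    define z where "z = (1 - u) *\<^sub>R x + u *\<^sub>R y"
    have "z \<in> P" unfolding z_def using u x y by (intro convexD[OF P(2)]) auto
    moreover have "g n z = 0"
    proof -
      have "g n z = (1 - u) * g n x + u * g n y" unfolding z_def
        by (simp add: affine_form_convex_comb[OF h])
      also have "\<dots> = g n x - u * (g n x - g n y)" by (simp add: algebra_simps)
      also have "\<dots> = 0" unfolding u_def using x y by simp
      finally show ?thesis .
    qed
    moreover have "?a z = X"
    proof -
      have "g i z = 0 \<longleftrightarrow> g i x = 0" if i: "i \<in> I" for i
      proof -
        have e: "g i z = (1 - u) * g i x + u * g i y" unfolding z_def using g[OF i]
          by (simp add: affine_form_convex_comb)
        have nn: "g i x \<ge> 0" "g i y \<ge> 0" using pos[OF i] x y by auto
        have "g i x = 0 \<longleftrightarrow> g i y = 0" using x(2) y(2) i unfolding active_def by blast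
        then show ?thesis using convex_comb_eq_0_iff[OF nn u] unfolding e by blast
      qed
      then show ?thesis using x(2) unfolding active_def by blast
    qed
    ultimately have "insert n X = active (insert n I) g z" "0 \<le> g n z" "z \<in> P" using act by auto
    then show ?thesis by blast
  qed
  have "?B \<subseteq> ?L"
  proof
    fix Y assume "Y \<in> ?B"
    then obtain X where "Y = insert n X" "X \<in> {X \<in> ?a ` P. \<not> S \<subseteq> X \<and> X \<union> S \<in> ?a ` P}"
      by (rule imageE)
    then show "Y \<in> ?L" using 3[of X] by (metis (no_types, lifting) mem_Collect_eq)
  qed
  then show ?thesis using 1 2 by (intro subset_antisym subsetI) (simp, elim UnE, simp, rule subsetD)
qed

text \<open>A nonempty face is recovered from any relative interior point \<open>x\<close> as the
  set of points of \<open>P\<close> at which all constraints active at \<open>x\<close> are active.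
  Constraints active nowhere on \<open>P\<close>, such as facets already cut off, do no
  harm.\<close>

lemma faces_active:
  fixes g :: "'i \<Rightarrow> 'a::euclidean_space \<Rightarrow> real"
  assumes A: "affine A" and I: "finite I" and g: "\<And>i. i \<in> I \<Longrightarrow> affine_form (g i)"
    and P: "P = {x \<in> A. \<forall>i\<in>I. 0 \<le> g i x}"
  shows "bij_betw (active_face P I g) (active I g ` P) (face_poset P)"
    and "X \<in> active I g ` P \<Longrightarrow> Y \<in> active I g ` P \<Longrightarrow>
      active_face P I g X \<subseteq> active_face P I g Y \<longleftrightarrow> Y \<subseteq> X"
proof -
  let ?a = "active I g" and ?f = "active_face P I g"
  have conv: "convex P"
  proof -
    have "P = A \<inter> (\<Inter>i\<in>I. {x. 0 \<le> g i x})" unfolding P by auto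
    then show ?thesis using affine_form_convex(1)[OF g] affine_imp_convex[OF A]
      by (auto intro!: convex_Int convex_INT)
  qed
  have face: "?f T face_of P" if "T \<subseteq> I" for T
    by (rule active_face_face_of[OF conv g _ that]) (auto simp: P)
  have self: "x \<in> ?f (?a x)" if "x \<in> P" for x using that unfolding active_face_def by blast
  show ord: "?f X \<subseteq> ?f Y \<longleftrightarrow> Y \<subseteq> X" if X: "X \<in> ?a ` P" and Y: "Y \<in> ?a ` P" for X Y
  proof
    assume s: "?f X \<subseteq> ?f Y"
    obtain x where "x \<in> P" "X = ?a x" using X by blast
    then show "Y \<subseteq> X" using s self[of x] unfolding active_face_def by blast
  qed (auto simp: active_face_def)
  have inj: "inj_on ?f (?a ` P)" by (rule inj_onI) (metis ord subset_antisym order_refl)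
  have sub: "?f X \<in> face_poset P" if X: "X \<in> ?a ` P" for X
  proof -
    have "X \<subseteq> I" using X unfolding active_def by blast
    moreover obtain x where "x \<in> P" "X = ?a x" using X by blast
    then have "?f X \<noteq> {}" using self[of x] by auto
    ultimately show ?thesis using face unfolding face_poset_def by blast
  qed
  have sur: "\<exists>X \<in> ?a ` P. f = ?f X" if f: "f \<in> face_poset P" for f
  proof -
    have f': "f face_of P" "f \<noteq> {}" using f unfolding face_poset_def by auto
    then obtain x where x: "x \<in> rel_interior f"
      using rel_interior_eq_empty face_of_imp_convex by blast
    then have xf: "x \<in> f" using rel_interior_subset by blast
    then have xP: "x \<in> P" using f' face_of_imp_subset by blast
    have aI: "?a x \<subseteq> I" unfolding active_def by blast
    have "f \<subseteq> ?f (?a x)"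
      using subset_of_face_of[OF face[OF aI] face_of_imp_subset[OF f'(1)]] x self[OF xP] by blast
    moreover have "y \<in> f" if y: "y \<in> ?f (?a x)" for y
    proof (cases "y = x")
      case False
      have yP: "y \<in> P" using y unfolding active_face_def by blast
      \<comment> \<open>The segment from \<open>y\<close> can be prolonged beyond \<open>x\<close>
        inside \<open>P\<close>: constraints active at \<open>x\<close> vanish at \<open>y\<close>
        as well, and the others are positive at \<open>x\<close>.\<close>
      have "\<forall>\<^sub>F e in at_right (0::real). \<forall>i\<in>I. 0 \<le> g i (x + (-e) *\<^sub>R (y - x))"
      proof (rule eventually_ball_finite[OF I], rule ballI)
        fix i assume i: "i \<in> I"
        have e: "g i (x + (-e) *\<^sub>R (y - x)) = g i x - e * (g i y - g i x)" for e
          using affine_form_line[OF g[OF i], of x "-e" y] by simp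
        show "\<forall>\<^sub>F e in at_right 0. 0 \<le> g i (x + (-e) *\<^sub>R (y - x))"
        proof (cases "g i x = 0")
          case True
          then have "g i y = 0" using y i unfolding active_face_def active_def by blast
          then show ?thesis unfolding e using True by simp
        next
          case False
          then have "0 < g i x" using xP i unfolding P by force
          moreover have "((\<lambda>e. g i x - e * (g i y - g i x)) \<longlongrightarrow> g i x - 0 * (g i y - g i x)) (at_right 0)"
            by (intro tendsto_intros)
          ultimately have "\<forall>\<^sub>F e in at_right 0. 0 < g i x - e * (g i y - g i x)"
            by (intro order_tendstoD(1)) auto
          then show ?thesis unfolding e by eventually_elim simp
        qed
      qed
      moreover have "\<forall>\<^sub>F e in at_right (0::real). 0 < e" by (rule eventually_at_right_less)
      ultimately have "\<forall>\<^sub>F e in at_right (0::real). 0 < e \<and> (\<forall>i\<in>I. 0 \<le> g i (x + (-e) *\<^sub>R (y - x)))"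
        by eventually_elim simp
      then obtain e :: real where e: "0 < e" "\<forall>i\<in>I. 0 \<le> g i (x + (-e) *\<^sub>R (y - x))"
        using eventually_happens' trivial_limit_at_right_real by blast
      define z where "z = x + (-e) *\<^sub>R (y - x)"
      have z1: "z = (1 + e) *\<^sub>R x + (-e) *\<^sub>R y" unfolding z_def by (simp add: algebra_simps)
      have "z \<in> A" unfolding z1 by (rule mem_affine[OF A]) (use xP yP P in auto)
      then have zP: "z \<in> P" using e(2) unfolding P z_def by simp
      have "x \<in> open_segment y z"
      proof -
        \<comment> \<open>Chosen so that \<open>x = (1 - u) *\<^sub>R y + u *\<^sub>R z\<close>; the
          face property then puts \<open>y\<close> into \<open>f\<close>.\<close>
        define u where "u = 1 / (1 + e)"
        have u: "0 < u" "u < 1" "u * e = 1 - u" "u * (1 + e) = 1" unfolding u_def using e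
          by (auto simp: field_simps)
        have "(1 - u) *\<^sub>R y + u *\<^sub>R z = (u * (1 + e)) *\<^sub>R x + (1 - u - u * e) *\<^sub>R y"
          unfolding z1 by (simp add: algebra_simps)
        then have "x = (1 - u) *\<^sub>R y + u *\<^sub>R z" using u by simp
        moreover have "y \<noteq> z"
        proof
          assume "y = z"
          then have "(1 + e) *\<^sub>R (y - x) = 0" unfolding z_def by (simp add: algebra_simps)
          then show False using e False by simp
        qed
        ultimately show ?thesis using u unfolding in_segment by blast
      qed
      then show ?thesis using f'(1) yP zP xf unfolding face_of_def by blast
    qed (use xf in simp)
    ultimately have "f = ?f (?a x)" by blast
    then show ?thesis using xP by blast
  qed
  show "bij_betw ?f (?a ` P) (face_poset P)"
    unfolding bij_betw_def using inj sub sur by blast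
qed

section \<open>Barycentric coordinates of a labelled simplex\<close>

lemma affine_form_sum:
  assumes "affine_form h" "sum u C = 1"
  shows "h (\<Sum>c\<in>C. u c *\<^sub>R c) = (\<Sum>c\<in>C. u c * h c)"
proof -
  obtain a k where h: "\<And>x. h x = a \<bullet> x + k" using assms(1) unfolding affine_form_def by blast
  have "(\<Sum>c\<in>C. u c * h c) = (\<Sum>c\<in>C. u c * (a \<bullet> c)) + (\<Sum>c\<in>C. u c) * k"
    unfolding h by (simp add: algebra_simps sum.distrib sum_distrib_left)
  then show ?thesis unfolding h by (simp add: inner_sum_right assms(2))
qed

text \<open>With \<open>p\<close> as origin the other points are linearly independent, so a linear
  map can take the value \<open>-1\<close> on all of them; adding 1 makes it vanish there.\<close>

lemma barycentric_form:
  fixes C :: "'a::euclidean_space set"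
  assumes C: "\<not> affine_dependent C" and p: "p \<in> C"
  obtains h where "affine_form h" "h p = 1" "\<And>c. c \<in> C \<Longrightarrow> c \<noteq> p \<Longrightarrow> h c = 0"
proof -
  have "independent ((\<lambda>x. - p + x) ` (C - {p}))"
    using affine_dependent_iff_dependent2[OF p] C by blast
  then obtain f :: "'a \<Rightarrow> real" where f: "linear f" "\<And>x. x \<in> (\<lambda>x. - p + x) ` (C - {p}) \<Longrightarrow> f x = - 1"
    using linear_independent_extend[of _ "\<lambda>_. - 1"] by blast
  define h where "h x = 1 + f (x - p)" for x
  have "f x = adjoint f 1 \<bullet> x" for x
    using adjoint_works[OF f(1), of x 1] by (simp add: inner_commute)
  then have "affine_form h" unfolding affine_form_def h_def
    by (intro exI[of _ "adjoint f 1"] exI[of _ "1 - adjoint f 1 \<bullet> p"]) (simp add: inner_simps)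
  moreover have "h p = 1" unfolding h_def using linear_0[OF f(1)] by simp
  moreover have "h c = 0" if "c \<in> C" "c \<noteq> p" for c
    unfolding h_def using f(2)[of "c - p"] that by force
  ultimately show ?thesis by (rule that)
qed

text \<open>The facet \<open>G v\<close> lies opposite a vertex \<open>p v\<close>, and
  \<open>l v\<close> is the barycentric coordinate of that vertex. The coordinates sum to 1, so they
  cannot all vanish, but any proper subset of them can.\<close>

lemma labelled_simplex_forms:
  fixes \<Delta> :: "'a::euclidean_space set"
  assumes ls: "labelled_simplex V \<Delta> G" and V: "finite V"
  obtains A and l :: "'v \<Rightarrow> 'a \<Rightarrow> real" where "affine A" "compact \<Delta>"
    "\<And>v. v \<in> V \<Longrightarrow> affine_form (l v)"
    "\<Delta> = {x \<in> A. \<forall>v\<in>V. 0 \<le> l v x}"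
    "\<And>v. v \<in> V \<Longrightarrow> G v = {x \<in> \<Delta>. l v x = 0}"
    "active V l ` \<Delta> = {S. S \<subset> V}"
    "\<And>S. S \<subseteq> V \<Longrightarrow> aff_dim (simplex_face \<Delta> G S) = int (card V) - 1 - int (card S)"
proof -
  obtain C where C: "\<not> affine_dependent C" "card C = card V" "\<Delta> = convex hull C"
    using ls unfolding labelled_simplex_def simplex_def by auto
  have finC: "finite C" using C(1) by (rule aff_independent_finite)
  have indep: "\<not> affine_dependent C'" if "C' \<subseteq> C" for C'
    using C(1) that affine_dependent_subset by blast
  have dim: "aff_dim (convex hull C') = int (card C') - 1" if "C' \<subseteq> C" for C'
    using aff_dim_affine_independent[OF indep[OF that]] by (simp add: aff_dim_convex_hull)
  have G: "bij_betw G V {F. F face_of \<Delta> \<and> aff_dim F = aff_dim \<Delta> - 1}"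
    using ls unfolding labelled_simplex_def by blast
  have "\<exists>q. q \<in> C \<and> G v = convex hull (C - {q})" if v: "v \<in> V" for v
  proof -
    have f: "G v face_of \<Delta>" "aff_dim (G v) = aff_dim \<Delta> - 1" using bij_betwE[OF G] v by auto
    then obtain c where c: "c \<subseteq> C" "G v = convex hull c"
      using face_of_convex_hull_affine_independent[OF C(1)] C(3) by auto
    then have "int (card C) = int (card c) + 1" using f(2) dim[OF c(1)] dim[of C] C(3) by simp
    \<comment> \<open>A face of one dimension less omits exactly one vertex.\<close>
    then have "card (C - c) = 1" using c(1) finC finite_subset by (subst card_Diff_subset) auto
    then obtain q where "C - c = {q}" by (auto simp: card_1_singleton_iff)
    then have "q \<in> C" "c = C - {q}" using c(1) by auto
    then show ?thesis using c(2) by blast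
  qed
  then obtain p where p: "\<And>v. v \<in> V \<Longrightarrow> p v \<in> C" "\<And>v. v \<in> V \<Longrightarrow> G v = convex hull (C - {p v})"
    by metis
  have inj: "inj_on p V"
    using bij_betw_imp_inj_on[OF G] p(2) unfolding inj_on_def by metis
  then have pV: "p ` V = C"
    using p(1) C(2) V finC by (intro card_subset_eq) (auto simp: card_image)
  have "\<forall>q\<in>C. \<exists>h. affine_form h \<and> h q = 1 \<and> (\<forall>c\<in>C. c \<noteq> q \<longrightarrow> h c = 0)"
    using barycentric_form[OF C(1)] by metis
  then obtain b where b: "\<And>q. q \<in> C \<Longrightarrow> affine_form (b q)" "\<And>q. q \<in> C \<Longrightarrow> b q q = 1"
    "\<And>q c. q \<in> C \<Longrightarrow> c \<in> C \<Longrightarrow> c \<noteq> q \<Longrightarrow> b q c = 0"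
    by metis
  have coord: "b q (\<Sum>c\<in>C. u c *\<^sub>R c) = u q" if "sum u C = 1" "q \<in> C" for u q
  proof -
    have "b q (\<Sum>c\<in>C. u c *\<^sub>R c) = (\<Sum>c\<in>C. u c * b q c)"
      by (rule affine_form_sum[OF b(1)]) (use that in auto)
    also have "\<dots> = (\<Sum>c\<in>C. if c = q then u q else 0)"
      using b that(2) by (intro sum.cong) auto
    also have "\<dots> = u q" using that(2) finC by simp
    finally show ?thesis .
  qed
  \<comment> \<open>Stated for every \<open>C'\<close>, so that it covers the simplex, its facets
    and every \<open>simplex_face\<close> at once.\<close>
  have hull: "convex hull C' = {x \<in> affine hull C. (\<forall>q\<in>C. 0 \<le> b q x) \<and> (\<forall>q\<in>C - C'. b q x = 0)}"
    if C': "C' \<subseteq> C" for C'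
  proof (intro subset_antisym subsetI)
    fix x assume "x \<in> convex hull C'"
    then obtain u where u: "\<forall>c\<in>C'. 0 \<le> u c" "sum u C' = 1" "(\<Sum>c\<in>C'. u c *\<^sub>R c) = x"
      using convex_hull_finite[OF finite_subset[OF C' finC]] by auto
    define u' where "u' c = (if c \<in> C' then u c else 0)" for c
    have s: "sum u' C = 1"
      unfolding u(2)[symmetric] using C' finC
        by (intro sum.mono_neutral_cong_right) (auto simp: u'_def)
    have x: "(\<Sum>c\<in>C. u' c *\<^sub>R c) = x"
      unfolding u(3)[symmetric] using C' finC
        by (intro sum.mono_neutral_cong_right) (auto simp: u'_def)
    have "x \<in> affine hull C" using s x affine_hull_finite[OF finC] by auto
    moreover have "b q x = u' q" if "q \<in> C" for q using coord[OF s that] x by simp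
    ultimately show "x \<in> {x \<in> affine hull C. (\<forall>q\<in>C. 0 \<le> b q x) \<and> (\<forall>q\<in>C - C'. b q x = 0)}"
      using u(1) unfolding u'_def by auto
  next
    fix x assume x: "x \<in> {x \<in> affine hull C. (\<forall>q\<in>C. 0 \<le> b q x) \<and> (\<forall>q\<in>C - C'. b q x = 0)}"
    then obtain u where u: "sum u C = 1" "(\<Sum>c\<in>C. u c *\<^sub>R c) = x"
      using affine_hull_finite[OF finC] by auto
    have uq: "b q x = u q" if "q \<in> C" for q using coord[OF u(1) that] u(2) by simp
    then have z: "u q = 0" if "q \<in> C - C'" for q using x that by auto
    have "sum u C' = sum u C" using C' finC z by (intro sum.mono_neutral_left) auto
    moreover have "(\<Sum>c\<in>C'. u c *\<^sub>R c) = (\<Sum>c\<in>C. u c *\<^sub>R c)"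
      using C' finC z by (intro sum.mono_neutral_left) auto
    moreover have "\<forall>c\<in>C'. 0 \<le> u c" using x uq C' by auto
    ultimately show "x \<in> convex hull C'" using u convex_hull_finite[OF finite_subset[OF C' finC]]
      by auto
  qed
  define l where "l v = b (p v)" for v
  have \<Delta>: "\<Delta> = {x \<in> affine hull C. \<forall>v\<in>V. 0 \<le> l v x}"
  proof -
    have "\<Delta> = {x \<in> affine hull C. \<forall>q\<in>p ` V. 0 \<le> b q x}" using hull[of C] C(3) pV by simp
    then show ?thesis unfolding l_def by simp
  qed
  have Gv: "G v = {x \<in> \<Delta>. l v x = 0}" if v: "v \<in> V" for v
    using p(1)[OF v] unfolding p(2)[OF v] C(3) hull[OF subset_refl] hull[OF Diff_subset] l_def
      by auto
  have sf: "simplex_face \<Delta> G S = convex hull (C - p ` S)" if S: "S \<subseteq> V" for S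
  proof -
    have "p ` S \<subseteq> C" using S pV by blast
    moreover have "simplex_face \<Delta> G S = {x \<in> \<Delta>. \<forall>v\<in>S. l v x = 0}"
      unfolding simplex_face_def using Gv S by auto
    ultimately show ?thesis
      unfolding C(3) hull[OF subset_refl] hull[OF Diff_subset] l_def by auto
  qed
  have adim: "aff_dim (simplex_face \<Delta> G S) = int (card V) - 1 - int (card S)" if S: "S \<subseteq> V" for S
  proof -
    have "card (p ` S) = card S" "p ` S \<subseteq> C" using inj S pV
      by (auto intro: card_image inj_on_subset)
    then have "card (C - p ` S) = card V - card S" using finC C(2) finite_subset
      by (subst card_Diff_subset) auto
    moreover have "card S \<le> card V" using S V by (rule card_mono[rotated])
    ultimately show ?thesis unfolding sf[OF S] by (subst dim) auto
  qed
  have act: "active V l ` \<Delta> = {S. S \<subset> V}"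
  proof (intro subset_antisym subsetI)
    fix S assume "S \<in> active V l ` \<Delta>"
    then obtain x where x: "x \<in> \<Delta>" "S = active V l x" by blast
    \<comment> \<open>With all coordinates zero, \<open>x\<close> would lie in the hull of the empty
      set.\<close>
    have "S \<noteq> V"
    proof
      assume "S = V"
      then have "\<forall>q\<in>C. b q x = 0" using x(2) unfolding active_def l_def pV[symmetric] by auto
      then have "x \<in> convex hull {}" using x(1) hull[of "{}"] hull[of C] C(3) by auto
      then show False by simp
    qed
    then show "S \<in> {S. S \<subset> V}" using x(2) unfolding active_def by blast
  next
    fix S assume "S \<in> {S. S \<subset> V}"
    then have S: "S \<subset> V" by simp
    \<comment> \<open>The barycentre of the vertices opposite to the facets outside \<open>S\<close>
      lies on exactly the facets labelled by \<open>S\<close>.\<close>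
    define C' where "C' = p ` (V - S)"
    have C': "C' \<subseteq> C" "C' \<noteq> {}" unfolding C'_def using S pV by auto
    define m where "m = real (card C')"
    have m: "m > 0" unfolding m_def using C' finC finite_subset by (auto simp: card_gt_0_iff)
    define u where "u c = (if c \<in> C' then 1 / m else 0)" for c
    have "sum u C = (\<Sum>c\<in>C'. 1 / m)"
      using C' finC by (intro sum.mono_neutral_cong_right) (auto simp: u_def)
    then have s: "sum u C = 1" using m by (simp add: m_def)
    define x where "x = (\<Sum>c\<in>C. u c *\<^sub>R c)"
    have bx: "b q x = u q" if "q \<in> C" for q unfolding x_def by (rule coord[OF s that])
    have "x \<in> affine hull C" using s affine_hull_finite[OF finC] unfolding x_def by auto
    then have "x \<in> \<Delta>" unfolding C(3) hull[OF subset_refl] using bx m by (auto simp: u_def)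
    moreover have "active V l x = S"
    proof -
      have "l v x = 0 \<longleftrightarrow> v \<in> S" if v: "v \<in> V" for v
      proof -
        have "p v \<in> C' \<longleftrightarrow> v \<notin> S" unfolding C'_def using inj v S
          by (metis Diff_iff Diff_subset inj_on_image_mem_iff)
        then show ?thesis unfolding l_def bx[OF p(1)[OF v]] u_def using m by auto
      qed
      then show ?thesis unfolding active_def using S by auto
    qed
    ultimately show "S \<in> active V l ` \<Delta>" by blast
  qed
  show ?thesis
  proof (rule that[OF affine_affine_hull _ _ \<Delta> Gv act adim])
    show "compact \<Delta>" unfolding C(3) using finC by (rule finite_imp_compact_convex_hull)
    show "affine_form (l v)" if "v \<in> V" for v unfolding l_def using b(1) p(1) that by blast
  qed
qed

section \<open>The faces of a graph-associahedron\<close>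

definition tube_building :: "('v, 'e) pre_digraph \<Rightarrow> 'v set set" where
  "tube_building \<Gamma> = insert (verts \<Gamma>) {t. tube \<Gamma> t}"

lemma building_set_tubes:
  assumes "verts \<Gamma> \<noteq> {}"
  shows "building_set (verts \<Gamma>) (tube_building \<Gamma>)"
  unfolding building_set_def
proof (intro conjI ballI impI)
  show "tube_building \<Gamma> \<subseteq> Pow (verts \<Gamma>) - {{}}"
    using assms unfolding tube_building_def tube_def by auto
  show "verts \<Gamma> \<in> tube_building \<Gamma>" unfolding tube_building_def by simp
  fix s t assume "s \<in> tube_building \<Gamma>" "t \<in> tube_building \<Gamma>" "s \<inter> t \<noteq> {}"
  then show "s \<union> t \<in> tube_building \<Gamma>"
    using conn_Un[of \<Gamma> s t] unfolding tube_building_def tube_conn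
    by (auto simp: sup.absorb1 sup.absorb2 psubset_imp_subset)
qed

lemma restriction_tube_building:
  assumes t: "tube \<Gamma> t"
  shows "restriction (tube_building \<Gamma>) t = tube_building (\<Gamma> \<restriction> t)"
proof -
  have "t \<subset> verts \<Gamma>" "conn \<Gamma> t" "t \<noteq> {}" using t conn_nonempty unfolding tube_conn by auto
  then show ?thesis
    unfolding restriction_def tube_building_def tube_conn using conn_induce[of _ t \<Gamma>] by auto
qed

lemma contraction_tube_building:
  assumes t: "tube \<Gamma> t"
  shows "contraction (verts \<Gamma>) (tube_building \<Gamma>) t = tube_building (reconnected_complement \<Gamma> t)"
proof -
  have t': "t \<subset> verts \<Gamma>" "conn \<Gamma> t" "t \<noteq> {}" using t conn_nonempty unfolding tube_conn by auto
  have "s \<in> contraction (verts \<Gamma>) (tube_building \<Gamma>) t \<longleftrightarrow>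
    s \<in> tube_building (reconnected_complement \<Gamma> t)" for s
  proof (cases "s \<noteq> {} \<and> s \<subset> verts \<Gamma> - t")
    case True
    then have "s \<subset> verts \<Gamma>" "s \<union> t \<subset> verts \<Gamma>" using t' by auto
    then show ?thesis
      using True conn_reconnected_complement[OF t'(2), of s]
      unfolding contraction_def tube_building_def tube_conn by auto
  next
    case False
    show ?thesis
    \<comment> \<open>This set is the whole node set of the complement. It lies in the contraction
      because \<open>s \<union> t\<close> is the node set of \<open>\<Gamma>\<close>, whatever its
      connectivity.\<close>
    proof (cases "s = verts \<Gamma> - t")
      case True
      moreover have "s \<union> t = verts \<Gamma>" "s \<noteq> {}" using t' True by auto
      ultimately show ?thesis unfolding contraction_def tube_building_def by auto
    next
      case n: False
      have "s \<notin> tube_building (reconnected_complement \<Gamma> t)"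
        using False n unfolding tube_building_def tube_def by auto
      moreover have "s \<notin> contraction (verts \<Gamma>) (tube_building \<Gamma>) t"
        using False n unfolding contraction_def by auto
      ultimately show ?thesis by blast
    qed
  qed
  then show ?thesis by blast
qed

section \<open>Complexes of active sets between the truncations\<close>

definition label_set :: "'v + 'v set \<Rightarrow> 'v set" where
  "label_set = case_sum (\<lambda>v. {v}) id"

lemma label_set_simps [simp]: "label_set (Inl v) = {v}" "label_set (Inr t) = t"
  unfolding label_set_def by auto

text \<open>
  \<open>Inl v\<close> indexes the facet \<open>G v\<close> of the simplex and \<open>Inr t\<close> the facet created
  by the truncation at \<open>t\<close>.
  Truncating at \<open>{v}\<close> cuts off \<open>G v\<close> entirely and replaces it by a new facet, so \<open>{v}\<close> has only
  one valid index at each stage.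
\<close>

definition stage_complex :: "'v set \<Rightarrow> 'v set set \<Rightarrow> ('v + 'v set) set set" where
  "stage_complex V T = {X. X \<subseteq> Inl ` V \<union> Inr ` T \<and> (\<forall>v. Inl v \<in> X \<longrightarrow> {v} \<notin> T) \<and>
     nested (insert V (T \<union> singletons V)) V (label_set ` X)}"

text \<open>Supplies the hypothesis \<open>down\<close> of \<open>truncation_step\<close>.\<close>

lemma stage_complex_subset: "X \<in> stage_complex V T \<Longrightarrow> Y \<subseteq> X \<Longrightarrow> Y \<in> stage_complex V T"
  unfolding stage_complex_def using nested_subset[of _ _ "label_set ` X" "label_set ` Y"] by blast

text \<open>Among singletons the only forbidden union is \<open>V\<close>, which leaves the boundary
  complex of a simplex.\<close>

lemma stage_complex_empty: "stage_complex V {} = (`) Inl ` {S. S \<subset> V}"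
proof -
  have lab: "label_set ` Inl ` S = singletons S" for S :: "'a set"
    unfolding singletons_def by (simp add: image_image)
  have "nested (insert V (singletons V)) V (singletons S) \<longleftrightarrow> S \<subset> V" if S: "S \<subseteq> V" for S
  proof
    assume n: "nested (insert V (singletons V)) V (singletons S)"
    have "S \<noteq> V"
      using nestedD[OF n, of "singletons S"] nested_in[OF n, of V] by auto
    then show "S \<subset> V" using S by blast
  next
    assume S: "S \<subset> V"
    have "\<Union>M \<in> M" if M: "M \<subseteq> singletons S" "\<Union>M \<in> insert V (singletons V)" for M
    proof -
      have "\<Union>M \<subseteq> S" using Union_mono[OF M(1)] by simp
      then obtain v where v: "\<Union>M = {v}" using M(2) S unfolding singletons_def by blast
      then obtain s where "s \<in> M" "v \<in> s" by blast
      moreover from this have "s = {v}" using M(1) unfolding singletons_def by auto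
      ultimately show ?thesis using v by simp
    qed
    moreover have "singletons S \<subseteq> insert V (singletons V) - {V}" using S unfolding singletons_def
      by auto
    ultimately show "nested (insert V (singletons V)) V (singletons S)" unfolding nested_def
      by blast
  qed
  then have "Inl ` S \<in> stage_complex V {} \<longleftrightarrow> S \<subset> V" if "S \<subseteq> V" for S
    unfolding stage_complex_def using that by (auto simp: lab)
  moreover have "\<exists>S\<subseteq>V. X = Inl ` S" if "X \<in> stage_complex V {}" for X
    using that unfolding stage_complex_def by (auto simp: subset_image_iff)
  ultimately show ?thesis by blast
qed

text \<open>The right-hand side is the formula of \<open>truncation_step\<close>. Stellar
  subdivision at a single vertex is a mere relabelling, so a one-element tube has its own case: the
  building set stays, and the index \<open>Inl w\<close> gives way to
  \<open>Inr {w}\<close>.\<close>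

lemma stage_complex_insert:
  assumes T: "T \<subseteq> Pow V - {{}, V}" and S: "S \<subset> V" "S \<noteq> {}" "S \<notin> T"
    and un: "\<And>t. t \<in> T \<Longrightarrow> t \<inter> S \<noteq> {} \<Longrightarrow> t \<union> S \<in> insert V T"
  shows "stage_complex V (insert S T) = {X \<in> stage_complex V T. \<not> Inl ` S \<subseteq> X} \<union>
    insert (Inr S) ` {X \<in> stage_complex V T. \<not> Inl ` S \<subseteq> X \<and> X \<union> Inl ` S \<in> stage_complex V T}"
    (is "?K' = ?R1 \<union> insert _ ` ?R2")
proof -
  let ?K = "stage_complex V T"
  let ?B = "insert V (T \<union> singletons V)"
  have noInr: "Inr S \<notin> X" if "X \<in> ?K" for X using that S(3) unfolding stage_complex_def by auto
  have both: "(X \<in> ?K' \<longleftrightarrow> X \<in> ?R1) \<and> (insert (Inr S) X \<in> ?K' \<longleftrightarrow> X \<in> ?R2)"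
    if nX: "Inr S \<notin> X" for X
  proof (cases "X \<subseteq> Inl ` V \<union> Inr ` T")
    case False
    then have "X \<notin> ?K'" "X \<notin> ?K" "insert (Inr S) X \<notin> ?K'"
      using nX unfolding stage_complex_def by auto
    then show ?thesis by blast
  next
    case Xsub: True
    show ?thesis
    proof (cases "\<exists>w. S = {w}")
      case True
      then obtain w where w: "S = {w}" by blast
      have B: "insert V (insert S T \<union> singletons V) = ?B" using w S(1) unfolding singletons_def
        by auto
      have "X \<in> ?K' \<longleftrightarrow> X \<in> ?R1"
        unfolding stage_complex_def B using nX w by auto
      moreover have "insert (Inr S) X \<in> ?K' \<longleftrightarrow> X \<in> ?R2"
      proof -
        have "label_set ` insert (Inr S) X = label_set ` (X \<union> Inl ` S)" using w by auto
        moreover have "nested ?B V (label_set ` X)" if "nested ?B V (label_set ` (X \<union> Inl ` S))"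
          using nested_subset[OF that] by blast
        ultimately show ?thesis
          unfolding stage_complex_def B using nX w S by auto
      qed
      ultimately show ?thesis by blast
    next
      case False
      then have two: "\<And>v. S \<noteq> {v}" by blast
      have B: "insert V (insert S T \<union> singletons V) = insert S ?B" by blast
      have Tin: "t \<noteq> {}" "t \<noteq> V" if "t \<in> T" for t using T that by auto
      have h1: "S \<notin> ?B" using S two unfolding singletons_def by auto
      \<comment> \<open>An earlier tube inside \<open>S\<close> would make
        \<open>S = t \<union> S\<close> one of the sets already present.\<close>
      have TS: "\<not> t \<subseteq> S" if t: "t \<in> T" for t
      proof
        assume "t \<subseteq> S"
        then have "t \<union> S = S" "t \<inter> S \<noteq> {}" using Tin[OF t] by auto
        then show False using un[OF t] S by auto
      qed
      have h3: "s \<in> singletons S" if "s \<in> ?B" "s \<subseteq> S" for s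
        using that TS S(1) unfolding singletons_def by auto
      have h4: "{} \<notin> ?B" using T S(1) unfolding singletons_def by auto
      have h5: "{v} \<in> ?B" "{v} \<noteq> V" if "v \<in> S" for v
        using that S two[of v] unfolding singletons_def by auto
      have h6: "s \<in> singletons S \<or> s \<union> S \<in> ?B" if "s \<in> ?B" "s \<inter> S \<noteq> {}" for s
        using that un S(1) unfolding singletons_def by (auto simp: sup.absorb1 psubset_imp_subset)
      have L1: "S \<notin> label_set ` X"
        using Xsub S(3) two unfolding label_set_def by (force split: sum.splits)
      \<comment> \<open>A label \<open>{v}\<close> with \<open>v \<in> S\<close> can only come from
        \<open>Inl v\<close>, since by \<open>TS\<close> no earlier tube is
        \<open>{v}\<close>.\<close>
      have L2: "singletons S \<subseteq> label_set ` X \<longleftrightarrow> Inl ` S \<subseteq> X"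
      proof
        assume sub: "singletons S \<subseteq> label_set ` X"
        show "Inl ` S \<subseteq> X"
        proof
          fix x :: "'a + 'a set" assume "x \<in> Inl ` S"
          then obtain v where v: "x = Inl v" "v \<in> S" by blast
          then obtain y where y: "y \<in> X" "label_set y = {v}" using sub unfolding singletons_def
            by blast
          show "x \<in> X"
          proof (cases y)
            case (Inl u)
            then show ?thesis using y v by simp
          next
            case (Inr r)
            then have "{v} \<in> T" using y Xsub by auto
            then show ?thesis using TS v(2) by blast
          qed
        qed
      next
        assume "Inl ` S \<subseteq> X"
        then show "singletons S \<subseteq> label_set ` X" unfolding singletons_def by (force simp: image_iff)
      qed
      have L3: "label_set ` (X \<union> Inl ` S) = label_set ` X \<union> singletons S"
        unfolding singletons_def by (simp add: image_Un image_image)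
      have L4: "label_set ` insert (Inr S) X = insert S (label_set ` X)" by simp
      have old: "nested (insert S ?B) V (label_set ` X) \<longleftrightarrow>
          nested ?B V (label_set ` X) \<and> \<not> singletons S \<subseteq> label_set ` X"
        by (rule nested_insert_old) (fact h1 less_imp_neq[OF S(1)] two h3 h4 h5 h6 L1)+
      have new: "nested (insert S ?B) V (insert S (label_set ` X)) \<longleftrightarrow>
          nested ?B V (label_set ` X) \<and> \<not> singletons S \<subseteq> label_set ` X \<and>
          nested ?B V (label_set ` X \<union> singletons S)"
        by (rule nested_insert_new) (fact h1 less_imp_neq[OF S(1)] two h3 h4 h5 h6 L1)+
      have sing: "{v} \<in> insert S T \<longleftrightarrow> {v} \<in> T" for v using two[of v] by auto
      have SnT: "{v} \<notin> T" if "v \<in> S" for v using TS[of "{v}"] that by blast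
      have "X \<in> ?K' \<longleftrightarrow> X \<in> ?R1"
        unfolding stage_complex_def B mem_Collect_eq sing old L2 using Xsub by auto
      moreover have "insert (Inr S) X \<in> ?K' \<longleftrightarrow> X \<in> ?R2"
        unfolding stage_complex_def B mem_Collect_eq sing L4 new L2 L3 using Xsub S(1) SnT by auto
      ultimately show ?thesis by blast
    qed
  qed
  show ?thesis
  proof (intro subset_antisym subsetI)
    fix X assume X: "X \<in> ?K'"
    show "X \<in> ?R1 \<union> insert (Inr S) ` ?R2"
    proof (cases "Inr S \<in> X")
      case True
      then have "X = insert (Inr S) (X - {Inr S})" by blast
      moreover from this have "X - {Inr S} \<in> ?R2" using both[of "X - {Inr S}"] X
        by (simp del: mem_Collect_eq)
      ultimately show ?thesis by blast
    next
      case False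
      then show ?thesis using both[of X] X by blast
    qed
  next
    fix X assume "X \<in> ?R1 \<union> insert (Inr S) ` ?R2"
    then show "X \<in> ?K'"
    proof
      assume X: "X \<in> ?R1"
      then show "X \<in> ?K'" using both[of X] noInr[of X] by blast
    next
      assume "X \<in> insert (Inr S) ` ?R2"
      then obtain Y where Y: "X = insert (Inr S) Y" "Y \<in> ?R2" by (rule imageE)
      then have "Inr S \<notin> Y" using noInr[of Y] by blast
      then show "X \<in> ?K'" using both[of Y] Y by blast
    qed
  qed
qed

lemma polyhedron_affine_forms:
  assumes A: "affine A" and I: "finite I" and g: "\<And>i. i \<in> I \<Longrightarrow> affine_form (g i)"
  shows "polyhedron {x \<in> A. \<forall>i\<in>I. 0 \<le> g i x}"
proof -
  have "polyhedron {x. 0 \<le> g i x}" if i: "i \<in> I" for i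
  proof -
    obtain a c where "\<And>x. g i x = a \<bullet> x + c" using g[OF i] unfolding affine_form_def by blast
    then have "{x. 0 \<le> g i x} = {x. a \<bullet> x \<ge> - c}" by auto
    then show ?thesis by (simp add: polyhedron_halfspace_ge)
  qed
  then have "polyhedron (A \<inter> (\<Inter>i\<in>I. {x. 0 \<le> g i x}))"
    using I by (intro polyhedron_Int[OF affine_imp_polyhedron[OF A]] polyhedron_Inter) auto
  moreover have "A \<inter> (\<Inter>i\<in>I. {x. 0 \<le> g i x}) = {x \<in> A. \<forall>i\<in>I. 0 \<le> g i x}" by auto
  ultimately show ?thesis by simp
qed

text \<open>By \<open>ls\<close>, increasing dimension of the simplex faces means decreasing size of
  the tubes. A proper union is a tube; if it came at position \<open>i\<close> or later, sizes would
  force it to equal \<open>ts ! i\<close>, and then \<open>t\<close> as well, against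
  distinctness.\<close>

lemma tubes_union_before:
  assumes ls: "\<And>S. S \<subseteq> verts \<Gamma> \<Longrightarrow> aff_dim (simplex_face \<Delta> G S) = int (card (verts \<Gamma>)) - 1 - int (card S)"
    and V: "finite (verts \<Gamma>)"
    and ts: "distinct ts" "set ts = {t. tube \<Gamma> t}"
    and sorted: "sorted_wrt (\<lambda>s t. aff_dim (simplex_face \<Delta> G s) \<le> aff_dim (simplex_face \<Delta> G t)) ts"
    and i: "i < length ts" and t: "t \<in> set (take i ts)" "t \<inter> ts ! i \<noteq> {}"
  shows "t \<union> ts ! i \<in> insert (verts \<Gamma>) (set (take i ts))"
proof (rule ccontr)
  assume no: "t \<union> ts ! i \<notin> insert (verts \<Gamma>) (set (take i ts))"
  let ?S = "ts ! i" and ?U = "t \<union> ts ! i"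
  have le: "card (ts ! k) \<le> card (ts ! j)" if jk: "j \<le> k" "k < length ts" for j k
  proof (cases "j = k")
    case False
    have "ts ! j \<subseteq> verts \<Gamma>" "ts ! k \<subseteq> verts \<Gamma>"
      using ts(2) jk nth_mem[of j ts] nth_mem[of k ts] unfolding tube_def by auto
    then show ?thesis using sorted_wrt_nth_less[OF sorted, of j k] False jk ls by simp
  qed simp
  obtain j where j: "j < i" "t = ts ! j" using t(1) i by (auto simp: in_set_conv_nth)
  have tubes: "tube \<Gamma> t" "tube \<Gamma> ?S"
    using ts(2) i j nth_mem[of j ts] nth_mem[of i ts] by auto
  then have fin: "finite ?U" using V finite_subset unfolding tube_def by blast
  have "tube \<Gamma> ?U" using tubes conn_Un[of \<Gamma> t ?S] t(2) no unfolding tube_conn by auto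
  then obtain k where k: "k < length ts" "?U = ts ! k"
    using ts(2) in_set_conv_nth[of ?U ts] by auto
  have "i \<le> k"
  proof (rule ccontr)
    assume "\<not> i \<le> k"
    then have "ts ! k \<in> set (take i ts)" using k(1) i nth_mem[of k "take i ts"] by simp
    then have "?U \<in> set (take i ts)" unfolding k(2) .
    then show False using no by blast
  qed
  then have "card ?U \<le> card ?S" unfolding k(2) using le k(1) by blast
  then have "?S = ?U" using fin by (intro card_seteq) auto
  then have "t \<subseteq> ?S" by blast
  moreover have "card ?S \<le> card t" using le[of j i] j i by simp
  ultimately have "t = ?S" using fin by (intro card_seteq) auto
  then show False using ts(1) i j by (simp add: nth_eq_iff_index_eq)
qed

text \<open>No index \<open>Inl v\<close> survives: either \<open>{v}\<close> is a tube, which the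
  second clause of \<open>stage_complex\<close> excludes, or \<open>{v}\<close> is the whole node
  set, which is never in a nested family.\<close>

lemma final_complex:
  assumes "finite (verts \<Gamma>)"
  shows "stage_complex (verts \<Gamma>) {t. tube \<Gamma> t} =
    (`) Inr ` {T. nested (tube_building \<Gamma>) (verts \<Gamma>) T}"
proof -
  let ?V = "verts \<Gamma>"
  have sing: "{v} = ?V \<or> tube \<Gamma> {v}" if "v \<in> ?V" for v
    using conn_singleton[of \<Gamma> v] that unfolding tube_conn by auto
  then have B: "insert ?V ({t. tube \<Gamma> t} \<union> singletons ?V) = tube_building \<Gamma>"
    unfolding singletons_def tube_building_def by auto
  have lab: "label_set ` Inr ` T = T" for T :: "'a set set" by (simp add: image_image)
  have "X \<in> (`) Inr ` {T. nested (tube_building \<Gamma>) ?V T}"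
    if X: "X \<in> stage_complex ?V {t. tube \<Gamma> t}" for X
  proof -
    have X': "X \<subseteq> Inl ` ?V \<union> Inr ` {t. tube \<Gamma> t}" "\<And>v. Inl v \<in> X \<Longrightarrow> \<not> tube \<Gamma> {v}"
      "nested (tube_building \<Gamma>) ?V (label_set ` X)"
      using X unfolding stage_complex_def B by auto
    have "Inl v \<notin> X" for v
    proof
      assume v: "Inl v \<in> X"
      then have "v \<in> ?V" "\<not> tube \<Gamma> {v}" using X' by auto
      moreover have "{v} \<in> label_set ` X" using v by (intro image_eqI[of _ _ "Inl v"]) auto
      ultimately show False using nested_in[OF X'(3)] sing by blast
    qed
    then have "X \<subseteq> range Inr" using X'(1) by blast
    then obtain T where "X = Inr ` T" by (auto simp: subset_image_iff)
    then show ?thesis using X'(3) lab by auto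
  qed
  moreover have "Inr ` T \<in> stage_complex ?V {t. tube \<Gamma> t}"
    if T: "nested (tube_building \<Gamma>) ?V T" for T
  proof -
    have "T \<subseteq> {t. tube \<Gamma> t}" using T unfolding nested_def tube_building_def by blast
    then show ?thesis using T unfolding stage_complex_def B by (auto simp: lab)
  qed
  ultimately show ?thesis
    by (intro subset_antisym subsetI) (assumption | erule imageE | simp)+
qed

text \<open>Along the prefixes of \<open>ts\<close>, \<open>truncation_step\<close> and
  \<open>stage_complex_insert\<close> change the geometric and the combinatorial complex by the same
  formula; \<open>faces_active\<close> turns the last complex into the face poset.\<close>

lemma associahedron_faces:
  fixes \<Gamma> :: "('v, 'e) pre_digraph" and P :: "'a::euclidean_space set"
  assumes V: "finite (verts \<Gamma>)" and ga: "graph_associahedron \<Gamma> P F"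
  defines "N \<equiv> {T. nested (tube_building \<Gamma>) (verts \<Gamma>) T}"
  shows "bij_betw (tubing_face P F) N (face_poset P)"
    and "T \<in> N \<Longrightarrow> T' \<in> N \<Longrightarrow> tubing_face P F T \<subseteq> tubing_face P F T' \<longleftrightarrow> T' \<subseteq> T"
    and "polyhedron P"
proof -
  let ?V = "verts \<Gamma>"
  obtain \<Delta> G ts a b where
    ls: "labelled_simplex ?V \<Delta> G" and ts: "distinct ts" "set ts = {t. tube \<Gamma> t}"
    and sorted: "sorted_wrt (\<lambda>s t. aff_dim (simplex_face \<Delta> G s) \<le> aff_dim (simplex_face \<Delta> G t)) ts"
    and trunc: "\<And>i. i < length ts \<Longrightarrow> truncates (truncation_stage \<Delta> a b (take i ts))
          (simplex_face \<Delta> G (ts ! i) \<inter> truncation_stage \<Delta> a b (take i ts)) (a (ts ! i)) (b (ts ! i))"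
    and P: "P = truncation_stage \<Delta> a b ts"
    and F: "\<And>t. tube \<Gamma> t \<Longrightarrow> F t = P \<inter> {x. a t \<bullet> x = b t}"
    using ga unfolding graph_associahedron_def by (elim exE conjE) (rule that, auto)
  obtain A and l :: "'v \<Rightarrow> 'a \<Rightarrow> real" where A: "affine A" "compact \<Delta>"
    and l: "\<And>v. v \<in> ?V \<Longrightarrow> affine_form (l v)"
    and \<Delta>: "\<Delta> = {x \<in> A. \<forall>v\<in>?V. 0 \<le> l v x}"
    and G: "\<And>v. v \<in> ?V \<Longrightarrow> G v = {x \<in> \<Delta>. l v x = 0}"
    and act0: "active ?V l ` \<Delta> = {S. S \<subset> ?V}"
    and dim: "\<And>S. S \<subseteq> ?V \<Longrightarrow> aff_dim (simplex_face \<Delta> G S) = int (card ?V) - 1 - int (card S)"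
    by (rule labelled_simplex_forms[OF ls V]) (rule that)
  \<comment> \<open>Simplex facets and halfspaces are indexed uniformly, so every stage is
    \<open>Q\<close> of the tubes used so far.\<close>
  define g where "g = case_sum l (\<lambda>t x. b t - a t \<bullet> x)"
  define I :: "'v set set \<Rightarrow> ('v + 'v set) set" where "I T = Inl ` ?V \<union> Inr ` T" for T
  define Q where "Q T = {x \<in> A. \<forall>i\<in>I T. 0 \<le> g i x}" for T
  have gr: "affine_form (g (Inr t))" for t
    unfolding g_def affine_form_def by (intro exI[of _ "- a t"] exI[of _ "b t"]) simp
  have g: "affine_form (g i)" if "i \<in> I T" for i T
    using that gr l unfolding I_def g_def by auto
  have stage: "truncation_stage \<Delta> a b rs = Q (set rs)" for rs
    unfolding truncation_stage_def Q_def \<Delta> I_def g_def by (auto simp: ball_Un)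
  have Qconv: "convex (Q T)" and Qcomp: "compact (Q T)" for T
  proof -
    have e: "Q T = \<Delta> \<inter> (\<Inter>t\<in>T. {x. 0 \<le> g (Inr t) x})" unfolding Q_def \<Delta> I_def g_def
      by (auto simp: ball_Un)
    show "compact (Q T)" unfolding e
      using A(2) affine_form_closed[OF gr] by (intro compact_Int_closed closed_INT) auto
    have "Q T = A \<inter> (\<Inter>i\<in>I T. {x. 0 \<le> g i x})" unfolding Q_def by auto
    then show "convex (Q T)" using affine_form_convex(1)[OF g] affine_imp_convex[OF A(1)]
      by (auto intro!: convex_Int convex_INT)
  qed
  have main: "active (I (set (take i ts))) g ` Q (set (take i ts)) = stage_complex ?V (set (take i ts))"
    if "i \<le> length ts" for i
    using that
  proof (induction i)
    case 0
    have "active (I {}) g x = Inl ` active ?V l x" for x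
      unfolding active_def I_def g_def by auto
    then have "active (I {}) g ` \<Delta> = (`) Inl ` active ?V l ` \<Delta>" by (simp add: image_image)
    moreover have "Q {} = \<Delta>" using stage[of "[]"] unfolding truncation_stage_def by simp
    ultimately show ?case using stage_complex_empty[of ?V] act0 by simp
  next
    case (Suc i)
    define T where "T = set (take i ts)"
    define S where "S = ts ! i"
    have i: "i < length ts" using Suc by simp
    have IH: "active (I T) g ` Q T = stage_complex ?V T" using Suc unfolding T_def by simp
    have T': "set (take (Suc i) ts) = insert S T" unfolding T_def S_def using i
      by (simp add: take_Suc_conv_app_nth)
    have St: "tube \<Gamma> S" unfolding S_def using ts(2) i nth_mem by blast
    then have S: "S \<subset> ?V" "S \<noteq> {}" unfolding tube_def by auto
    have ST: "S \<notin> T" unfolding S_def T_def using ts(1) i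
      by (auto simp: in_set_conv_nth nth_eq_iff_index_eq)
    have Tt: "T \<subseteq> Pow ?V - {{}, ?V}"
      using ts(2) set_take_subset[of i ts] unfolding T_def tube_def by auto
    have un: "t \<union> S \<in> insert ?V T" if "t \<in> T" "t \<inter> S \<noteq> {}" for t
      using tubes_union_before[OF dim V ts sorted i] that unfolding T_def S_def by blast
    have GS: "G v = {x \<in> \<Delta>. l v x = 0}" if "v \<in> S" for v using G S(1) that by blast
    \<comment> \<open>The face prescribed for truncation is the one where the original constraints
      \<open>Inl v\<close> with \<open>v \<in> S\<close> are active, the form that
      \<open>truncation_step\<close> expects.\<close>
    have "simplex_face \<Delta> G S \<inter> Q T = {x \<in> Q T. \<forall>v\<in>S. l v x = 0}"
      unfolding simplex_face_def using GS by (auto simp: Q_def \<Delta> I_def g_def ball_Un)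
    also have "\<dots> = active_face (Q T) (I T) g (Inl ` S)"
      unfolding active_face_def active_def I_def g_def using S(1) by auto
    finally have f: "simplex_face \<Delta> G S \<inter> Q T = active_face (Q T) (I T) g (Inl ` S)" .
    have tr: "truncates (Q T) (active_face (Q T) (I T) g (Inl ` S)) (a S) (b S)"
      using trunc[OF i] unfolding stage S_def[symmetric] T_def[symmetric] f .
    have cut: "(0 \<le> g (Inr S) v \<longleftrightarrow> v \<notin> active_face (Q T) (I T) g (Inl ` S)) \<and> g (Inr S) v \<noteq> 0"
      if "v extreme_point_of Q T" for v
      using tr that unfolding truncates_def by (auto simp: g_def)
    have QS: "Q (insert S T) = {x \<in> Q T. 0 \<le> g (Inr S) x}" unfolding Q_def I_def by auto
    have IS: "I (insert S T) = insert (Inr S) (I T)" unfolding I_def by auto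
    have "active (I (insert S T)) g ` Q (insert S T) =
      {X \<in> active (I T) g ` Q T. \<not> Inl ` S \<subseteq> X} \<union>
      insert (Inr S) ` {X \<in> active (I T) g ` Q T. \<not> Inl ` S \<subseteq> X \<and> X \<union> Inl ` S \<in> active (I T) g ` Q T}"
      unfolding QS IS
    proof (rule truncation_step[OF Qcomp Qconv g _ _ _ gr _ cut])
      show "0 \<le> g i x" if "i \<in> I T" "x \<in> Q T" for i x using that unfolding Q_def by blast
      show "Inr S \<notin> I T" using ST unfolding I_def by auto
      show "Inl ` S \<subseteq> I T" using S unfolding I_def by auto
      show "Y \<in> active (I T) g ` Q T" if "X \<in> active (I T) g ` Q T" "Y \<subseteq> X" for X Y
        using stage_complex_subset that unfolding IH by blast
    qed
    also have "\<dots> = stage_complex ?V (insert S T)"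
      unfolding IH by (rule stage_complex_insert[OF Tt S ST un, symmetric])
    finally show ?case unfolding T' .
  qed
  define T where "T = {t. tube \<Gamma> t}"
  have PQ: "P = Q T" unfolding P stage ts(2) T_def ..
  have finI: "finite (I T)" using V ts(2) List.finite_set[of ts] unfolding I_def T_def by auto
  have act: "active (I T) g ` P = (`) Inr ` N"
    using main[of "length ts"] final_complex[OF V] unfolding PQ N_def T_def by (simp add: ts(2))
  have face: "active_face P (I T) g (Inr ` U) = tubing_face P F U" if "U \<in> N" for U
  proof -
    have "U \<subseteq> T" using that unfolding N_def nested_def tube_building_def T_def by blast
    then have FU: "F t = P \<inter> {x. a t \<bullet> x = b t}" if "t \<in> U" for t using F that unfolding T_def
      by blast
    have "tubing_face P F U = {x \<in> P. \<forall>t\<in>U. g (Inr t) x = 0}"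
      unfolding tubing_face_def g_def using FU by auto
    then show ?thesis
      unfolding active_face_def active_def I_def using \<open>U \<subseteq> T\<close> by auto
  qed
  note fa = faces_active[OF A(1) finI g PQ[unfolded Q_def], folded Q_def]
  have "bij_betw ((`) Inr) N ((`) Inr ` N)"
    by (intro bij_betw_imageI inj_on_image inj_onI) (auto dest: inj_image_eq_iff[THEN iffD1, rotated])
  then have "bij_betw (active_face P (I T) g \<circ> (`) Inr) N (face_poset P)"
    using fa(1) unfolding act by (rule bij_betw_trans)
  then show "bij_betw (tubing_face P F) N (face_poset P)"
    using face by (subst bij_betw_cong[of _ _ "active_face P (I T) g \<circ> (`) Inr"]) auto
  show "tubing_face P F U \<subseteq> tubing_face P F U' \<longleftrightarrow> U' \<subseteq> U" if U: "U \<in> N" "U' \<in> N" for U U'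
    using fa(2)[where X = "Inr ` U" and Y = "Inr ` U'"] U face unfolding act
      by (simp add: inj_image_subset_iff)
  show "polyhedron P" unfolding PQ Q_def by (rule polyhedron_affine_forms[OF A(1) finI g])
qed

section \<open>Facets of a graph-associahedron\<close>

lemma combinatorially_equivalentI:
  assumes \<alpha>: "bij_betw \<alpha> A (face_poset P)" and \<beta>: "bij_betw \<beta> A (face_poset Q)"
    and ord: "\<And>x y. x \<in> A \<Longrightarrow> y \<in> A \<Longrightarrow> \<alpha> x \<subseteq> \<alpha> y \<longleftrightarrow> \<beta> x \<subseteq> \<beta> y"
  shows "combinatorially_equivalent P Q"
  unfolding combinatorially_equivalent_def
proof (intro exI conjI ballI)
  let ?\<phi> = "\<beta> \<circ> inv_into A \<alpha>"
  have inv: "bij_betw (inv_into A \<alpha>) (face_poset P) A" using \<alpha> by (rule bij_betw_inv_into)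
  then show "bij_betw ?\<phi> (face_poset P) (face_poset Q)" using \<beta> by (rule bij_betw_trans)
  fix f g assume f: "f \<in> face_poset P" and g: "g \<in> face_poset P"
  have "\<alpha> (inv_into A \<alpha> f) = f" "\<alpha> (inv_into A \<alpha> g) = g"
    using bij_betw_inv_into_right[OF \<alpha>] f g by auto
  then show "f \<subseteq> g \<longleftrightarrow> ?\<phi> f \<subseteq> ?\<phi> g"
    using ord[of "inv_into A \<alpha> f" "inv_into A \<alpha> g"] bij_betwE[OF inv] f g by simp
qed

text \<open>A tube is compatible with itself: it contains itself and, being nonempty, is not
  disjoint from itself.\<close>

lemma k_tubing_1: "k_tubing \<Gamma> 1 T \<longleftrightarrow> (\<exists>t. T = {t} \<and> tube \<Gamma> t)"
  unfolding k_tubing_def tubing_def tubes_intersect_def tubes_adjacent_def tube_def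
  by (auto simp: card_1_singleton_iff)

lemma nested_singleton:
  assumes "tube \<Gamma> t"
  shows "nested (tube_building \<Gamma>) (verts \<Gamma>) {t}"
proof -
  have t: "t \<noteq> {}" "t \<noteq> verts \<Gamma>" "t \<in> tube_building \<Gamma>" "verts \<Gamma> \<noteq> {}"
    using assms unfolding tube_def tube_building_def by auto
  have "{} \<notin> tube_building \<Gamma>" using t(4) unfolding tube_building_def tube_def by auto
  then have "\<Union>M \<in> M" if "M \<subseteq> {t}" "\<Union>M \<in> tube_building \<Gamma>" for M
    using that by (cases "M = {}") (auto simp: subset_singleton_iff)
  then show ?thesis using t unfolding nested_def by blast
qed

text \<open>Inclusion is reversed, so facets, as maximal proper faces, belong to the minimal
  nonempty nested sets, which are the singletons.\<close>

lemma facets_bij: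
  assumes V: "finite (verts \<Gamma>)" and ga: "graph_associahedron \<Gamma> P F"
  shows "bij_betw (tubing_face P F) {T. k_tubing \<Gamma> 1 T} {f. f facet_of P}"
proof -
  let ?\<Phi> = "tubing_face P F"
  define N where "N = {T. nested (tube_building \<Gamma>) (verts \<Gamma>) T}"
  note faces = associahedron_faces[OF V ga, folded N_def]
  have empty: "?\<Phi> {} = P" unfolding tubing_face_def by simp
  have single: "{t} \<in> N" "{} \<in> N" if "tube \<Gamma> t" for t
    using nested_singleton[OF that] nested_subset unfolding N_def by blast+
  have inj: "inj_on ?\<Phi> N" using faces(1) by (rule bij_betw_imp_inj_on)
  have facet_in: "\<exists>T\<in>N. f = ?\<Phi> T \<and> T \<noteq> {}" if f: "f facet_of P" for f
  proof -
    have "f \<in> face_poset P" "f \<noteq> P" using f unfolding facet_of_def face_poset_def by auto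
    then obtain T where "T \<in> N" "f = ?\<Phi> T" using bij_betw_imp_surj_on[OF faces(1)] by blast
    then show ?thesis using \<open>f \<noteq> P\<close> empty by blast
  qed
  have facet: "?\<Phi> {t} facet_of P" if t: "tube \<Gamma> t" for t
  proof -
    have "?\<Phi> {t} \<in> face_poset P" using bij_betwE[OF faces(1)] single[OF t] by blast
    then have "?\<Phi> {t} face_of P" "?\<Phi> {t} \<noteq> {}" unfolding face_poset_def by auto
    moreover have "?\<Phi> {t} \<noteq> P" using inj_onD[OF inj, of "{t}" "{}"] single[OF t] empty by auto
    \<comment> \<open>In a polyhedron a proper nonempty face lies in some facet; by order reversal
      only \<open>{t}\<close> is left as the nested set of that facet.\<close>
    ultimately obtain f where f: "f facet_of P" "?\<Phi> {t} \<subseteq> f"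
      using face_of_polyhedron_subset_facet[OF faces(3)] by metis
    obtain T where T: "T \<in> N" "f = ?\<Phi> T" "T \<noteq> {}" using facet_in[OF f(1)] by blast
    then have "T \<subseteq> {t}" using faces(2)[of "{t}" T] f(2) single[OF t] by simp
    then have "T = {t}" using T(3) by blast
    then show ?thesis using f(1) T(2) by simp
  qed
  have "\<exists>t. tube \<Gamma> t \<and> f = ?\<Phi> {t}" if f: "f facet_of P" for f
  proof -
    obtain T where T: "T \<in> N" "f = ?\<Phi> T" "T \<noteq> {}" using facet_in[OF f] by blast
    then obtain t where t: "t \<in> T" by blast
    then have tube: "tube \<Gamma> t" using T(1) unfolding N_def nested_def tube_building_def by blast
    have sub: "f \<subseteq> ?\<Phi> {t}" using faces(2)[of T "{t}"] T t single[OF tube] by simp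
    have g: "?\<Phi> {t} facet_of P" by (rule facet[OF tube])
    \<comment> \<open>Two facets, one inside the other, coincide because they have the same
      dimension.\<close>
    have "f face_of ?\<Phi> {t}"
      using f g sub by (meson facet_of_imp_face_of face_of_face)
    moreover have "convex (?\<Phi> {t})" using g facet_of_imp_face_of face_of_imp_convex by blast
    moreover have "aff_dim f = aff_dim (?\<Phi> {t})" using f g unfolding facet_of_def by simp
    ultimately have "f = ?\<Phi> {t}" using face_of_aff_dim_lt[of "?\<Phi> {t}" f] by linarith
    then show ?thesis using tube by blast
  qed
  then have "{f. f facet_of P} = (\<lambda>t. ?\<Phi> {t}) ` {t. tube \<Gamma> t}" using facet by blast
  moreover have "{T. k_tubing \<Gamma> 1 T} = (\<lambda>t. {t}) ` {t. tube \<Gamma> t}" unfolding k_tubing_1 by blast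
  ultimately have "?\<Phi> ` {T. k_tubing \<Gamma> 1 T} = {f. f facet_of P}"
    by (simp add: image_image)
  moreover have "{T. k_tubing \<Gamma> 1 T} \<subseteq> N" using single(1) unfolding k_tubing_1 by auto
  then have "inj_on ?\<Phi> {T. k_tubing \<Gamma> 1 T}" using inj inj_on_subset by blast
  ultimately show ?thesis unfolding bij_betw_def by blast
qed

text \<open>Leaving out the empty face makes the factors of a product face unique; products with an
  empty factor would all coincide.\<close>

lemma face_poset_Times:
  fixes Q :: "'b::euclidean_space set" and R :: "'c::euclidean_space set"
  assumes \<alpha>: "bij_betw \<alpha> A (face_poset Q)" and \<beta>: "bij_betw \<beta> B (face_poset R)"
  shows "bij_betw (\<lambda>(X, Y). \<alpha> X \<times> \<beta> Y) (A \<times> B) (face_poset (Q \<times> R))"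
proof -
  have ne: "\<alpha> X \<noteq> {}" "\<beta> Y \<noteq> {}" if "X \<in> A" "Y \<in> B" for X Y
    using bij_betwE[OF \<alpha>] bij_betwE[OF \<beta>] that unfolding face_poset_def by auto
  have "inj_on (\<lambda>(X, Y). \<alpha> X \<times> \<beta> Y) (A \<times> B)"
    using ne inj_onD[OF bij_betw_imp_inj_on[OF \<alpha>]] inj_onD[OF bij_betw_imp_inj_on[OF \<beta>]]
    by (intro inj_onI) (auto simp: times_eq_iff)
  moreover have "face_poset (Q \<times> R) = (\<lambda>(f, g). f \<times> g) ` (face_poset Q \<times> face_poset R)"
    unfolding face_poset_def face_of_Times_decomp by auto
  then have "face_poset (Q \<times> R) = (\<lambda>(X, Y). \<alpha> X \<times> \<beta> Y) ` (A \<times> B)"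
    unfolding bij_betw_imp_surj_on[OF \<alpha>, symmetric] bij_betw_imp_surj_on[OF \<beta>, symmetric] by force
  ultimately show ?thesis unfolding bij_betw_def by simp
qed

text \<open>The faces of the facet are indexed by the nested sets containing \<open>t\<close>, and
  \<open>nested_link\<close> splits these into the pairs that index the faces of
  \<open>Q \<times> R\<close>.\<close>

lemma facet_product:
  fixes P :: "'a::euclidean_space set" and Q :: "'b::euclidean_space set"
    and R :: "'c::euclidean_space set"
  assumes V: "finite (verts \<Gamma>)" and P: "graph_associahedron \<Gamma> P F" and t: "tube \<Gamma> t"
    and Q: "graph_associahedron (\<Gamma> \<restriction> t) Q FQ"
    and R: "graph_associahedron (reconnected_complement \<Gamma> t) R FR"
  shows "combinatorially_equivalent (tubing_face P F {t}) (Q \<times> R)"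
proof -
  let ?\<Phi> = "tubing_face P F" and ?B = "tube_building \<Gamma>" and ?V = "verts \<Gamma>"
  have tV: "t \<in> ?B" "t \<noteq> ?V" "?V \<noteq> {}" "finite t" using t V finite_subset
    unfolding tube_building_def tube_def by auto
  define N where "N = {T. nested ?B ?V T}"
  define NQ where "NQ = {X. nested (restriction ?B t) t X}"
  define NR where "NR = {Y. nested (contraction ?V ?B t) (?V - t) Y}"
  note P_faces = associahedron_faces[OF V P, folded N_def]
  have Q_faces: "bij_betw (tubing_face Q FQ) NQ (face_poset Q)"
    "\<And>X X'. X \<in> NQ \<Longrightarrow> X' \<in> NQ \<Longrightarrow> tubing_face Q FQ X \<subseteq> tubing_face Q FQ X' \<longleftrightarrow> X' \<subseteq> X"
    using associahedron_faces[OF _ Q] tV(4) unfolding NQ_def restriction_tube_building[OF t] by auto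
  have R_faces: "bij_betw (tubing_face R FR) NR (face_poset R)"
    "\<And>Y Y'. Y \<in> NR \<Longrightarrow> Y' \<in> NR \<Longrightarrow> tubing_face R FR Y \<subseteq> tubing_face R FR Y' \<longleftrightarrow> Y' \<subseteq> Y"
    using associahedron_faces[OF _ R] V unfolding NR_def contraction_tube_building[OF t] by auto
  note link = nested_link[OF building_set_tubes[OF tV(3)] tV(1,2), folded NQ_def NR_def]
  have tN: "{t} \<in> N" using nested_singleton[OF t] unfolding N_def by simp
  have Nt: "{T. nested ?B ?V T \<and> t \<in> T} = {T \<in> N. t \<in> T}" unfolding N_def by simp
  have "?\<Phi> {t} face_of P" using bij_betwE[OF P_faces(1)] tN unfolding face_poset_def by auto
  \<comment> \<open>Faces of a face are the faces of \<open>P\<close> contained in it; by order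
    reversal they belong to the nested sets containing \<open>t\<close>.\<close>
  then have "face_poset (?\<Phi> {t}) = {f \<in> face_poset P. f \<subseteq> ?\<Phi> {t}}"
    unfolding face_poset_def using face_of_face by blast
  also have "\<dots> = ?\<Phi> ` {T \<in> N. t \<in> T}"
    unfolding bij_betw_imp_surj_on[OF P_faces(1), symmetric] using P_faces(2)[OF _ tN] by auto
  finally have "bij_betw ?\<Phi> {T \<in> N. t \<in> T} (face_poset (?\<Phi> {t}))"
    using inj_on_subset[OF bij_betw_imp_inj_on[OF P_faces(1)], of "{T \<in> N. t \<in> T}"]
    unfolding bij_betw_def by auto
  then have \<alpha>: "bij_betw (?\<Phi> \<circ> link_join ?B t) (NQ \<times> NR) (face_poset (?\<Phi> {t}))"
    using link(1) unfolding Nt by (rule bij_betw_trans[rotated])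
  have \<beta>: "bij_betw (\<lambda>(X, Y). tubing_face Q FQ X \<times> tubing_face R FR Y) (NQ \<times> NR) (face_poset (Q \<times> R))"
    by (rule face_poset_Times[OF Q_faces(1) R_faces(1)])
  show ?thesis
  proof (rule combinatorially_equivalentI[OF \<alpha> \<beta>])
    fix p q assume p: "p \<in> NQ \<times> NR" and q: "q \<in> NQ \<times> NR"
    obtain X Y X' Y' where pq: "p = (X, Y)" "q = (X', Y')" by fastforce
    have XY: "X \<in> NQ" "Y \<in> NR" "X' \<in> NQ" "Y' \<in> NR" using p q pq by auto
    have "link_join ?B t p \<in> N" "link_join ?B t q \<in> N" using bij_betwE[OF link(1)] p q unfolding Nt
      by auto
    \<comment> \<open>Inclusion of faces reverses inclusion of nested sets, hence
      \<open>link(2)\<close> is taken with \<open>q\<close> first.\<close>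
    then have "(?\<Phi> \<circ> link_join ?B t) p \<subseteq> (?\<Phi> \<circ> link_join ?B t) q \<longleftrightarrow> X' \<subseteq> X \<and> Y' \<subseteq> Y"
      using P_faces(2) link(2)[OF q p] pq by simp
    moreover have "tubing_face Q FQ X \<noteq> {}" "tubing_face R FR Y \<noteq> {}"
      using bij_betwE[OF Q_faces(1)] bij_betwE[OF R_faces(1)] XY unfolding face_poset_def by auto
    ultimately show "(?\<Phi> \<circ> link_join ?B t) p \<subseteq> (?\<Phi> \<circ> link_join ?B t) q \<longleftrightarrow>
      (\<lambda>(X, Y). tubing_face Q FQ X \<times> tubing_face R FR Y) p \<subseteq>
      (\<lambda>(X, Y). tubing_face Q FQ X \<times> tubing_face R FR Y) q"
      using Q_faces(2) R_faces(2) XY unfolding pq by (simp add: times_subset_iff)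
  qed
qed

theorem theorem2p9:
  fixes \<Gamma> :: "('v, 'e) pre_digraph"
    and P :: "'a::euclidean_space set"
    and F :: "'v set \<Rightarrow> 'a set"
  assumes "Digraph.graph \<Gamma>"
    and "graph_associahedron \<Gamma> P F"
  shows "bij_betw (tubing_face P F) {T. k_tubing \<Gamma> 1 T} {f. f facet_of P} \<and>
    (\<forall>t (Q :: 'b::euclidean_space set) FQ (R :: 'c::euclidean_space set) FR.
       k_tubing \<Gamma> 1 {t} \<longrightarrow>
       graph_associahedron (\<Gamma> \<restriction> t) Q FQ \<longrightarrow>
       graph_associahedron (reconnected_complement \<Gamma> t) R FR \<longrightarrow>
       combinatorially_equivalent (tubing_face P F {t}) (Q \<times> R))"
proof -
  interpret Digraph.graph \<Gamma> by fact
  show ?thesis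
    using facets_bij[OF finite_verts assms(2)] facet_product[OF finite_verts assms(2)]
    unfolding k_tubing_1 by auto
qed

end
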